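(* Let $\alpha,\beta>-1$ be such that the classical anti-Gaussian rule $H_1^{(n+1)}$ for the Jacobi weight $w_{\alpha,\beta}$ is not internal (for all sufficiently large $n$), and let $\theta(n)=\theta_{\max}(n,\alpha,\beta)$. Put $g(n)=\theta(n)-1$. Then, for $z\in\mathbb{C}$ not in a neighborhood of $[-1,1]$ and $n\to+\infty$, $$K_{H_{\theta(n)}}^{(n+1)}(z)\sim -K_G^{(n)}(z)\left(1-g(n)\,\frac{1+\rho(z)^2}{1-\rho(z)^2}\right),$$ $$K_{A_{\theta(n)}}^{(2n+1)}(z)\sim K_G^{(n)}(z)\,\frac{g(n)}{1-\rho(z)^2},$$ where $g(n)$ is such that $$g(n)\sim\begin{cases}\dfrac{2\alpha+1}{n}, & \alpha\le\beta,\\[2mm] \dfrac{2\beta+1}{n}, & \alpha\ge\beta.\end{cases}$$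
   Context: Here $\sim$ denotes asymptotic equality as $n\to+\infty$ (the ratio of the two sides tends to $1$). Weight and rules. $w_{\alpha,\beta}(x)=(1-x)^\alpha(1+x)^\beta$ on $(-1,1)$, $I(f)=\int_{-1}^1 f(x)w_{\alpha,\beta}(x)\,dx$, and $G^{(n)}$ is the $n$-point Gaussian rule for $I$. For $\theta>0$, the modified anti-Gaussian rule $H_\theta^{(n+1)}$ is the $(n+1)$-point quadrature rule satisfying $H_\theta^{(n+1)}(p)=(1+\theta)I(p)-\theta G^{(n)}(p)$ for all polynomials $p$ of degree at most $2n+1$; the case $\theta=1$ is the classical anti-Gaussian rule. The modified averaged rule is $A_\theta^{(2n+1)}=\frac{1}{1+\theta}H_\theta^{(n+1)}+\frac{\theta}{1+\theta}G^{(n)}$. A rule is internal if all its nodes lie in $[-1,1]$. Parameter. Let $$h(n,x,y)=1+\frac{(2x+1)n(n+x+y+1)+\frac12(x+1)(x+y)(x+y+1)}{n(n+y)\left(n+\frac{x+y}{2}+1\right)},\qquad \theta_{\max}(n,\alpha,\beta)=\min\{h(n,\alpha,\beta),h(n,\beta,\alpha)\}.$$ Kernels. Let $\{\phi_k\}_{k\ge0}$ be the monic orthogonal polynomials with respect to $w_{\alpha,\beta}$ on $(-1,1)$, with $\phi_{-1}=0$, and let $b_n=I(\phi_n^2)/I(\phi_{n-1}^2)$. The nodes of $H_\theta^{(n+1)}$ are the zeros of $\pi_{n+1,\theta}(x)=\phi_{n+1}(x)-\theta b_n\phi_{n-1}(x)$. For $z\notin[-1,1]$ set $$q_n(z)=\int_{-1}^1\frac{\phi_n(x)}{z-x}w_{\alpha,\beta}(x)\,dx,\qquad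 K_G^{(n)}(z)=\frac{q_n(z)}{\phi_n(z)},$$ $$q_{n+1,\theta}(z)=\int_{-1}^1\frac{\pi_{n+1,\theta}(x)}{z-x}w_{\alpha,\beta}(x)\,dx,\qquad K_{H_\theta}^{(n+1)}(z)=\frac{q_{n+1,\theta}(z)}{\pi_{n+1,\theta}(z)}=\frac{q_{n+1}(z)-\theta b_nq_{n-1}(z)}{\phi_{n+1}(z)-\theta b_n\phi_{n-1}(z)},$$ $$K_{A_\theta}^{(2n+1)}(z)=\frac{1}{1+\theta}K_{H_\theta}^{(n+1)}(z)+\frac{\theta}{1+\theta}K_G^{(n)}(z).$$ These are the kernels of the Cauchy integral representations of the remainders of $G^{(n)}$, $H_\theta^{(n+1)}$ and $A_\theta^{(2n+1)}$. Finally, $\rho(z)=z+\sqrt{z^2-1}$, with the sign of the square root chosen so that $|\rho(z)|>1$.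
   Formalization: The claims on K_A and on g(n) are stated only for min(α,β) ≠ -1/2; for min(α,β) = -1/2 and |max(α,β)| < 1/2 the classical rule is not internal, but g(n) is nonzero of order 1/n³, so g(n) ~ 0/n and the K_A formula both fail. *)

theory Defs
  imports "HOL-Analysis.Analysis" "HOL-Library.Poly_Mapping"
    "HOL-Computational_Algebra.Polynomial" "HOL-Library.Landau_Symbols"
begin

definition jacobi_weight :: "real \<Rightarrow> real \<Rightarrow> real \<Rightarrow> real" where
  "jacobi_weight \<alpha> \<beta> x = (1 - x) powr \<alpha> * (1 + x) powr \<beta>"

definition jacobi_int :: "real \<Rightarrow> real \<Rightarrow> (real \<Rightarrow> real) \<Rightarrow> real" where
  "jacobi_int \<alpha> \<beta> f = (LBINT x:{-1<..<1}. f x * jacobi_weight \<alpha> \<beta> x)"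

(* A quadrature rule is a finitely supported weight function; its nodes are its support. *)
type_synonym quad_rule = "real \<Rightarrow>\<^sub>0 real"

definition nodes :: "quad_rule \<Rightarrow> real set" where
  "nodes Q = Poly_Mapping.keys Q"

definition quad :: "quad_rule \<Rightarrow> (real \<Rightarrow> real) \<Rightarrow> real" where
  "quad Q f = (\<Sum>x\<in>nodes Q. Poly_Mapping.lookup Q x * f x)"

definition internal :: "quad_rule \<Rightarrow> bool" where
  "internal Q \<longleftrightarrow> nodes Q \<subseteq> {-1..1}"

definition gauss_rule :: "real \<Rightarrow> real \<Rightarrow> nat \<Rightarrow> quad_rule" where
  "gauss_rule \<alpha> \<beta> n = (THE Q. card (nodes Q) = n \<and>
     (\<forall>p. degree p < 2 * n \<longrightarrow> quad Q (poly p) = jacobi_int \<alpha> \<beta> (poly p)))"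

(* The (n+1)-point rule usually written H_theta^(n+1): the argument is n, not the number of nodes. *)
definition anti_gauss_rule :: "real \<Rightarrow> real \<Rightarrow> real \<Rightarrow> nat \<Rightarrow> quad_rule" where
  "anti_gauss_rule \<theta> \<alpha> \<beta> n = (THE Q. card (nodes Q) = n + 1 \<and>
     (\<forall>p. degree p \<le> 2 * n + 1 \<longrightarrow>
        quad Q (poly p) = (1 + \<theta>) * jacobi_int \<alpha> \<beta> (poly p) - \<theta> * quad (gauss_rule \<alpha> \<beta> n) (poly p)))"

definition h_aux :: "nat \<Rightarrow> real \<Rightarrow> real \<Rightarrow> real" where
  "h_aux n x y = 1 +
     ((2 * x + 1) * real n * (real n + x + y + 1) + 1/2 * (x + 1) * (x + y) * (x + y + 1)) /
     (real n * (real n + y) * (real n + (x + y) / 2 + 1))"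

definition theta_max :: "nat \<Rightarrow> real \<Rightarrow> real \<Rightarrow> real" where
  "theta_max n \<alpha> \<beta> = min (h_aux n \<alpha> \<beta>) (h_aux n \<beta> \<alpha>)"

definition monic_orth :: "real \<Rightarrow> real \<Rightarrow> nat \<Rightarrow> real poly" where
  "monic_orth \<alpha> \<beta> k = (THE p. degree p = k \<and> lead_coeff p = 1 \<and>
     (\<forall>r. degree r < k \<longrightarrow> jacobi_int \<alpha> \<beta> (\<lambda>x. poly p x * poly r x) = 0))"

(* The polynomial of index n - 1, with the convention that the one of index -1 is 0. *)
definition monic_orth_pred :: "real \<Rightarrow> real \<Rightarrow> nat \<Rightarrow> real poly" where
  "monic_orth_pred \<alpha> \<beta> n = (if n = 0 then 0 else monic_orth \<alpha> \<beta> (n - 1))"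

definition b_coeff :: "real \<Rightarrow> real \<Rightarrow> nat \<Rightarrow> real" where
  "b_coeff \<alpha> \<beta> n =
     jacobi_int \<alpha> \<beta> (\<lambda>x. (poly (monic_orth \<alpha> \<beta> n) x)\<^sup>2) /
     jacobi_int \<alpha> \<beta> (\<lambda>x. (poly (monic_orth_pred \<alpha> \<beta> n) x)\<^sup>2)"

definition node_poly :: "real \<Rightarrow> real \<Rightarrow> real \<Rightarrow> nat \<Rightarrow> real poly" where
  "node_poly \<theta> \<alpha> \<beta> n =
     monic_orth \<alpha> \<beta> (n + 1) - smult (\<theta> * b_coeff \<alpha> \<beta> n) (monic_orth_pred \<alpha> \<beta> n)"

definition weighted_cauchy :: "real \<Rightarrow> real \<Rightarrow> real poly \<Rightarrow> complex \<Rightarrow> complex" where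
  "weighted_cauchy \<alpha> \<beta> p z =
     (LBINT x:{-1<..<1}. of_real (poly p x) / (z - of_real x) * of_real (jacobi_weight \<alpha> \<beta> x))"

definition cpoly :: "real poly \<Rightarrow> complex \<Rightarrow> complex" where
  "cpoly p z = poly (map_poly of_real p) z"

definition K_G :: "real \<Rightarrow> real \<Rightarrow> nat \<Rightarrow> complex \<Rightarrow> complex" where
  "K_G \<alpha> \<beta> n z =
     weighted_cauchy \<alpha> \<beta> (monic_orth \<alpha> \<beta> n) z / cpoly (monic_orth \<alpha> \<beta> n) z"

(* As with the rules, K_H and K_A take the n of the superscripts (n+1) and (2n+1). *)
definition K_H :: "real \<Rightarrow> real \<Rightarrow> real \<Rightarrow> nat \<Rightarrow> complex \<Rightarrow> complex" where
  "K_H \<theta> \<alpha> \<beta> n z =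
     weighted_cauchy \<alpha> \<beta> (node_poly \<theta> \<alpha> \<beta> n) z / cpoly (node_poly \<theta> \<alpha> \<beta> n) z"

definition K_A :: "real \<Rightarrow> real \<Rightarrow> real \<Rightarrow> nat \<Rightarrow> complex \<Rightarrow> complex" where
  "K_A \<theta> \<alpha> \<beta> n z =
     of_real (1 / (1 + \<theta>)) * K_H \<theta> \<alpha> \<beta> n z + of_real (\<theta> / (1 + \<theta>)) * K_G \<alpha> \<beta> n z"

(* For z outside [-1,1] exactly one of the two choices of sign gives modulus greater than 1. *)
definition rho :: "complex \<Rightarrow> complex" where
  "rho z = (let s = csqrt (z\<^sup>2 - 1) in if cmod (z + s) > 1 then z + s else z - s)"

(* Asymptotic equality (ratio tending to 1) as n tends to infinity, for z not in a neighbourhood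
   of [-1,1]: the convergence is uniform on the complement of every such neighbourhood. *)
definition asymp_off_interval ::
    "(nat \<Rightarrow> complex \<Rightarrow> complex) \<Rightarrow> (nat \<Rightarrow> complex \<Rightarrow> complex) \<Rightarrow> bool" where
  "asymp_off_interval F E \<longleftrightarrow>
     (\<forall>U. open U \<and> complex_of_real ` {-1..1} \<subseteq> U \<longrightarrow>
        uniform_limit (- U) (\<lambda>n z. F n z / E n z) (\<lambda>_. 1) sequentially)"

end

theory Submission
  imports Defs "HOL-Real_Asymp.Real_Asymp"
begin

text \<open>
  Let \<open>\<phi>\<^sub>n\<close> be the monic Jacobi polynomials, \<open>h\<^sub>n\<close> their squared norms, \<open>q\<^sub>n\<close> the functions of the second
  kind, and let
  \<open>v\<^sub>n(z) = (1 / h\<^sub>n) \<integral> \<phi>\<^sub>n(x) \<phi>\<^sub>n\<^sub>+\<^sub>1(x) w(x) / (z - x) dx\<close>,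
  an off-diagonal entry of the resolvent of the Jacobi matrix (\<open>offdiag\<close> below). The three-term
  recurrence gives \<open>\<phi>\<^sub>n q\<^sub>n\<^sub>+\<^sub>1 = h\<^sub>n v\<^sub>n\<close> and \<open>\<phi>\<^sub>n\<^sub>+\<^sub>1 q\<^sub>n = h\<^sub>n (v\<^sub>n + 1)\<close>. Hence, with
  \<open>D = v\<^sub>n - \<theta> v\<^sub>n\<^sub>-\<^sub>1\<close>, the kernels satisfy the exact identities (\<open>kernel_ratios\<close>)
  \<open>K_H = K_G * (D - \<theta>) / (1 + D)\<close> and \<open>K_A = K_G * D / (1 + D)\<close>.

  Suppose that \<open>v\<^sub>n\<close> converges to some \<open>v\<close> with relative error \<open>O(1 / n\<^sup>2)\<close>. Then
  \<open>D = (v\<^sub>n - v\<^sub>n\<^sub>-\<^sub>1) - g v\<^sub>n\<^sub>-\<^sub>1\<close> tends to \<open>0\<close>, which gives the first claim, and since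
  \<open>n * g(n)\<close> tends to \<open>2 * min \<alpha> \<beta> + 1\<close> by inspection of its formula (\<open>theta_max_limit\<close>), the
  difference \<open>v\<^sub>n - v\<^sub>n\<^sub>-\<^sub>1\<close> is negligible against \<open>g v\<close> unless this limit is \<open>0\<close>, so that
  \<open>D \<sim> - g v\<close>. The second claim follows because \<open>v = 1 / (\<rho>\<^sup>2 - 1)\<close>.

  The asymptotics of \<open>v\<^sub>n\<close> (\<open>green_asymptotics\<close>) come from comparing the Jacobi matrix with the free
  one, whose diagonal is \<open>0\<close> and whose off-diagonal is \<open>1/2\<close>. The differential equation of the Jacobi
  polynomials yields their recurrence coefficients explicitly (\<open>rec_a_eq\<close>, \<open>rec_b_eq\<close>), and they
  differ from the free ones by \<open>O(1 / n\<^sup>2)\<close>. The free resolvent consists of powers of \<open>1 / \<rho>\<close> and so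
  decays exponentially away from the diagonal, while the entries of the perturbed resolvent are bounded by
  the reciprocal of the distance from \<open>z\<close> to the interval. The resolvent identity therefore
  transfers the rate \<open>1 / n\<^sup>2\<close> from the coefficients to the resolvent entries
  (\<open>perturbed_resolvent\<close>), uniformly in \<open>z\<close>, including near infinity.
\<close>

section \<open>Orthogonal polynomials of a positive functional\<close>

text \<open>Only linearity and positivity on squares of the Jacobi integral enter the three-term
  recurrence, so the orthogonal polynomials are constructed for any such functional.\<close>
locale positive_functional =
  fixes L :: "real poly \<Rightarrow> real"
  assumes L_add: "L (p + q) = L p + L q"
    and L_smult: "L (smult c p) = c * L p"
    and L_pos: "p \<noteq> 0 \<Longrightarrow> L (p * p) > 0"
begin

lemma L_0 [simp]: "L 0 = 0"
  using L_smult[of 0 0] by simp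

lemma L_minus: "L (- p) = - L p"
  using L_smult[of "-1" p] by simp

lemma L_diff: "L (p - q) = L p - L q"
  using L_add[of p "- q"] by (simp add: L_minus)

text \<open>Degree bounds are phrased through vanishing coefficients: unlike \<open>degree r < n\<close>, the
  condition that all coefficients from index \<open>n\<close> on vanish forces \<open>r = 0\<close> when \<open>n = 0\<close>, so no
  case distinction is needed in inductions.\<close>
definition is_monic_orth :: "nat \<Rightarrow> real poly \<Rightarrow> bool" where
  "is_monic_orth n p \<longleftrightarrow> coeff p n = 1 \<and> (\<forall>k>n. coeff p k = 0) \<and>
     (\<forall>r. (\<forall>k\<ge>n. coeff r k = 0) \<longrightarrow> L (p * r) = 0)"

lemma is_monic_orthI:
  assumes "coeff p n = 1" "\<And>k. k > n \<Longrightarrow> coeff p k = 0"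
    "\<And>r. \<forall>k\<ge>n. coeff r k = 0 \<Longrightarrow> L (p * r) = 0"
  shows "is_monic_orth n p"
  unfolding is_monic_orth_def using assms by blast

lemma is_monic_orth_coeff: "is_monic_orth n p \<Longrightarrow> coeff p n = 1"
  and is_monic_orth_above: "is_monic_orth n p \<Longrightarrow> k > n \<Longrightarrow> coeff p k = 0"
  and is_monic_orth_orth: "is_monic_orth n p \<Longrightarrow> \<forall>k\<ge>n. coeff r k = 0 \<Longrightarrow> L (p * r) = 0"
  unfolding is_monic_orth_def by blast+

lemma is_monic_orth_L_mult:
  assumes "is_monic_orth n p" "\<forall>k>n. coeff r k = 0"
  shows "L (p * r) = coeff r n * L (p * p)"
proof -
  have "\<forall>k\<ge>n. coeff (r - smult (coeff r n) p) k = 0"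
    using assms(2) is_monic_orth_coeff[OF assms(1)] is_monic_orth_above[OF assms(1)] by (simp add: le_less)
  hence "L (p * (r - smult (coeff r n) p)) = 0"
    by (rule is_monic_orth_orth[OF assms(1)])
  thus ?thesis by (simp add: right_diff_distrib L_diff L_smult)
qed

lemma is_monic_orth_unique:
  assumes p: "is_monic_orth n p" and q: "is_monic_orth n q" shows "p = q"
proof (rule ccontr)
  assume "p \<noteq> q"
  have *: "\<forall>k\<ge>n. coeff (p - q) k = 0"
    using is_monic_orth_coeff[OF p] is_monic_orth_coeff[OF q] is_monic_orth_above[OF p] is_monic_orth_above[OF q]
    by (simp add: le_less)
  have "L ((p - q) * (p - q)) = 0"
    using is_monic_orth_orth[OF p *] is_monic_orth_orth[OF q *] by (simp only: left_diff_distrib L_diff)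
  thus False using L_pos[of "p - q"] \<open>p \<noteq> q\<close> by simp
qed

text \<open>Stieltjes' procedure: the recurrence coefficients are read off from the polynomials that are
  already known. Existence of the orthogonal polynomials and their three-term recurrence come
  out of the same construction.\<close>
fun ortho :: "nat \<Rightarrow> real poly" where
  "ortho 0 = 1"
| "ortho (Suc 0) = [:- L [:0, 1:] / L 1, 1:]"
| "ortho (Suc (Suc n)) =
     [:- L ([:0, 1:] * ortho (Suc n) * ortho (Suc n)) / L (ortho (Suc n) * ortho (Suc n)), 1:] * ortho (Suc n)
     - smult (L (ortho (Suc n) * ortho (Suc n)) / L (ortho n * ortho n)) (ortho n)"

definition norm2 :: "nat \<Rightarrow> real" where
  "norm2 n = L (ortho n * ortho n)"

definition rec_a :: "nat \<Rightarrow> real" where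
  "rec_a n = L ([:0, 1:] * ortho n * ortho n) / norm2 n"

definition rec_b :: "nat \<Rightarrow> real" where
  "rec_b n = norm2 n / norm2 (n - 1)"

lemma ortho_Suc_0: "ortho (Suc 0) = [:- rec_a 0, 1:] * ortho 0"
  by (simp add: rec_a_def norm2_def)

lemma ortho_Suc_Suc: "ortho (Suc (Suc n)) =
    [:- rec_a (Suc n), 1:] * ortho (Suc n) - smult (rec_b (Suc n)) (ortho n)"
  by (simp add: rec_a_def rec_b_def norm2_def)

declare ortho.simps(2,3) [simp del]

text \<open>A polynomial of degree at most \<open>n + 1\<close> is a multiple of \<open>p\<close> plus a polynomial \<open>r'\<close> of degree
  at most \<open>n\<close>. The choice of \<open>a\<close> makes the new polynomial orthogonal to \<open>p\<close>. Against \<open>r'\<close>, the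
  term \<open>p * (x * r')\<close> contributes the top coefficient of \<open>r'\<close> times \<open>L (p * p)\<close>, and the
  choice of \<open>b\<close> cancels exactly this.\<close>
lemma is_monic_orth_Suc:
  assumes p: "is_monic_orth (Suc n) p" and q: "is_monic_orth n q"
  defines "a \<equiv> L ([:0, 1:] * p * p) / L (p * p)" and "b \<equiv> L (p * p) / L (q * q)"
  shows "is_monic_orth (Suc (Suc n)) ([:- a, 1:] * p - smult b q)" (is "is_monic_orth _ ?s")
proof -
  have p0: "p \<noteq> 0" and q0: "q \<noteq> 0"
    using is_monic_orth_coeff[OF p] is_monic_orth_coeff[OF q] by auto
  have Lp: "L (p * p) > 0" and Lq: "L (q * q) > 0" using L_pos p0 q0 by auto
  have cp: "coeff p (Suc n) = 1" "\<And>k. k > Suc n \<Longrightarrow> coeff p k = 0"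
    and cq: "coeff q n = 1" "\<And>k. k > n \<Longrightarrow> coeff q k = 0"
    using is_monic_orth_coeff is_monic_orth_above p q by blast+
  have coeff_s: "coeff ?s (Suc k) = - a * coeff p (Suc k) + coeff p k - b * coeff q (Suc k)" for k
    by simp
  have top: "coeff ?s (Suc (Suc n)) = 1" "\<forall>k>Suc (Suc n). coeff ?s k = 0"
  proof -
    show "coeff ?s (Suc (Suc n)) = 1" unfolding coeff_s using cp cq by simp
    show "\<forall>k>Suc (Suc n). coeff ?s k = 0"
    proof (intro allI impI)
      fix k assume "k > Suc (Suc n)"
      then obtain j where j: "k = Suc j" "j > Suc n" by (auto dest: Suc_lessE)
      show "coeff ?s k = 0" unfolding j coeff_s using cp(2) cq(2) j(2) by simp
    qed
  qed
  show ?thesis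
  proof (intro is_monic_orthI top(1) top(2)[rule_format])
    fix r :: "real poly" assume r: "\<forall>k\<ge>Suc (Suc n). coeff r k = 0"
    define r' where "r' = r - smult (coeff r (Suc n)) p"
    have r': "\<forall>k>n. coeff r' k = 0"
    proof (intro allI impI)
      fix k assume "k > n"
      hence "k = Suc n \<or> k > Suc n" by auto
      thus "coeff r' k = 0" using r cp by (auto simp: r'_def)
    qed
    have r'': "coeff r' k = 0" if "k \<ge> Suc n" for k using r' that by auto
    have 1: "L (?s * p) = 0"
    proof -
      have "\<forall>k\<ge>Suc n. coeff q k = 0" using cq by auto
      hence "L (p * q) = 0" by (rule is_monic_orth_orth[OF p])
      moreover have "?s * p = [:0, 1:] * p * p - smult a (p * p) - smult b (p * q)"
        by (simp add: algebra_simps)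
      ultimately show ?thesis using Lp by (simp add: L_diff L_smult a_def)
    qed
    have 2: "L (?s * r') = 0"
    proof -
      have "?s * r' = p * pCons 0 r' - smult a (p * r') - smult b (q * r')"
        by (simp add: algebra_simps)
      moreover have "L (p * pCons 0 r') = coeff r' n * L (p * p)"
        using is_monic_orth_L_mult[OF p, of "pCons 0 r'"] r' by (auto simp: coeff_pCons split: nat.splits)
      moreover have "L (p * r') = 0" using r'' by (intro is_monic_orth_orth[OF p]) blast
      moreover have "L (q * r') = coeff r' n * L (q * q)" using is_monic_orth_L_mult[OF q] r' by auto
      ultimately show ?thesis using Lq by (simp add: L_diff L_smult b_def)
    qed
    obtain c where r_eq: "r = smult c p + r'"
      by (rule that[of "coeff r (Suc n)"]) (simp add: r'_def)
    have "L (?s * (smult c p + r')) = 0"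
      using 1 2 by (simp only: distrib_left mult_smult_right L_add L_smult)
    thus "L (?s * r) = 0" unfolding r_eq .
  qed
qed

lemma is_monic_orth_ortho: "is_monic_orth n (ortho n)"
proof -
  have "is_monic_orth n (ortho n) \<and> is_monic_orth (Suc n) (ortho (Suc n))"
  proof (induction n)
    case 0
    have 0: "is_monic_orth 0 1"
    proof -
      have "L r = 0" if "\<forall>k. coeff r k = 0" for r :: "real poly"
        using that by (metis L_0 coeff_0 poly_eqI)
      thus ?thesis by (intro is_monic_orthI) simp_all
    qed
    have "L 1 > 0" using L_pos[of 1] by simp
    have "L ([:- L [:0, 1:] / L 1, 1:] * r) = 0" (is "L (?p * _) = 0") if "\<forall>k\<ge>Suc 0. coeff r k = 0" for r
    proof -
      have "r = [:coeff r 0:]" using that by (intro poly_eqI) (auto simp: coeff_pCons split: nat.splits)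
      then obtain c where c: "r = [:c:]" by blast
      have "?p * [:c:] = smult c ?p" by simp
      hence "L (?p * r) = c * L ?p" by (simp only: c L_smult)
      moreover have *: "?p = [:0,1:] - smult (L [:0, 1:] / L 1) 1" by simp
      have "L ?p = 0"
        unfolding * L_diff L_smult using \<open>L 1 > 0\<close> by simp
      ultimately show ?thesis by simp
    qed
    hence "is_monic_orth (Suc 0) (ortho (Suc 0))"
      unfolding ortho.simps by (intro is_monic_orthI) (simp_all add: coeff_pCons split: nat.splits)
    with 0 show ?case by simp
  next
    case (Suc n)
    thus ?case using is_monic_orth_Suc[of n "ortho (Suc n)" "ortho n"]
      by (simp add: ortho_Suc_Suc rec_a_def rec_b_def norm2_def)
  qed
  thus ?thesis by simp
qed

lemma coeff_ortho_self [simp]: "coeff (ortho n) n = 1"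
  and coeff_ortho_above: "k > n \<Longrightarrow> coeff (ortho n) k = 0"
  using is_monic_orth_coeff is_monic_orth_above is_monic_orth_ortho by blast+

lemma ortho_nonzero: "ortho n \<noteq> 0"
  by (metis coeff_0 coeff_ortho_self zero_neq_one)

lemma norm2_pos: "norm2 n > 0"
  unfolding norm2_def by (rule L_pos) (rule ortho_nonzero)

lemma rec_b_pos: "rec_b n > 0"
  by (simp add: rec_b_def norm2_pos)

lemma L_ortho_mult_ortho: "L (ortho j * ortho k) = (if j = k then norm2 j else 0)"
proof -
  have *: "L (ortho k * ortho j) = 0" if "j < k" for j k
  proof -
    have "\<forall>i\<ge>k. coeff (ortho j) i = 0" using that coeff_ortho_above by simp
    thus ?thesis by (rule is_monic_orth_orth[OF is_monic_orth_ortho])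
  qed
  show ?thesis using *[of j k] *[of k j]
    by (cases j k rule: linorder_cases) (auto simp: norm2_def mult.commute)
qed

lemma is_monic_orth_iff_degree:
  "is_monic_orth n p \<longleftrightarrow> degree p = n \<and> lead_coeff p = 1 \<and> (\<forall>r. degree r < n \<longrightarrow> L (p * r) = 0)"
proof
  assume p: "is_monic_orth n p"
  hence d: "degree p = n"
    by (intro antisym degree_le le_degree allI impI) (simp_all add: is_monic_orth_above is_monic_orth_coeff)
  have "L (p * r) = 0" if "degree r < n" for r
  proof -
    have "\<forall>k\<ge>n. coeff r k = 0" using that by (simp add: coeff_eq_0)
    thus ?thesis by (rule is_monic_orth_orth[OF p])
  qed
  thus "degree p = n \<and> lead_coeff p = 1 \<and> (\<forall>r. degree r < n \<longrightarrow> L (p * r) = 0)"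
    using d is_monic_orth_coeff[OF p] by simp
next
  assume p: "degree p = n \<and> lead_coeff p = 1 \<and> (\<forall>r. degree r < n \<longrightarrow> L (p * r) = 0)"
  have "L (p * r) = 0" if "\<forall>k\<ge>n. coeff r k = 0" for r
  proof (cases "r = 0")
    case False
    hence "degree r < n" using that by (meson leading_coeff_0_iff not_le)
    thus ?thesis using p by blast
  qed simp
  moreover have "coeff p n = 1" "\<forall>k>n. coeff p k = 0" using p by (auto simp: coeff_eq_0)
  ultimately show "is_monic_orth n p" unfolding is_monic_orth_def by blast
qed

lemma ortho_eqI:
  "(THE p. degree p = n \<and> lead_coeff p = 1 \<and> (\<forall>r. degree r < n \<longrightarrow> L (p * r) = 0)) = ortho n"
  unfolding is_monic_orth_iff_degree[symmetric]
  by (rule the_equality) (auto intro: is_monic_orth_ortho is_monic_orth_unique)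

end

section \<open>Recurrence coefficients of the Jacobi polynomials\<close>

text \<open>Besides positivity, the Jacobi integral satisfies the Pearson identity, which says that the
  derivative of \<open>(1 - x\<^sup>2) * w * f\<close> integrates to \<open>0\<close>. This is all that is needed to
  determine the recurrence coefficients.\<close>
locale jacobi_functional = positive_functional +
  fixes \<alpha> \<beta> :: real
  assumes \<alpha>: "\<alpha> > -1" and \<beta>: "\<beta> > -1"
    and pearson: "L ([:1, 0, -1:] * pderiv f + [:\<beta> - \<alpha>, - (\<alpha> + \<beta> + 2):] * f) = 0"
begin

definition jacobi_op :: "real poly \<Rightarrow> real poly" where
  "jacobi_op p = [:1, 0, -1:] * pderiv (pderiv p) + [:\<beta> - \<alpha>, - (\<alpha> + \<beta> + 2):] * pderiv p"

definition eigenvalue :: "nat \<Rightarrow> real" where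
  "eigenvalue n = - real n * (real n + \<alpha> + \<beta> + 1)"

lemma coeff_jacobi_op:
  "coeff (jacobi_op p) k = eigenvalue k * coeff p k + (\<beta> - \<alpha>) * (real k + 1) * coeff p (k + 1)
     + (real k + 1) * (real k + 2) * coeff p (k + 2)"
proof -
  consider "k = 0" | "k = 1" | j where "k = Suc (Suc j)"
    by (metis One_nat_def not0_implies_Suc)
  thus ?thesis
    by cases (simp_all add: jacobi_op_def eigenvalue_def coeff_pderiv algebra_simps numeral_2_eq_2)
qed

text \<open>The Pearson identity for \<open>f = p' * q\<close> turns \<open>L (jacobi_op p * q)\<close> into
  \<open>- L ((1 - x\<^sup>2) * p' * q')\<close>, which is symmetric in \<open>p\<close> and \<open>q\<close>.\<close>
lemma jacobi_op_symmetric: "L (jacobi_op p * q) = L (p * jacobi_op q)"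
proof -
  have *: "L (jacobi_op p * q) = - L ([:1, 0, -1:] * (pderiv p * pderiv q))" for p q
  proof -
    have "jacobi_op p * q = ([:1, 0, -1:] * pderiv (pderiv p * q)
        + [:\<beta> - \<alpha>, - (\<alpha> + \<beta> + 2):] * (pderiv p * q)) - [:1, 0, -1:] * (pderiv p * pderiv q)"
      unfolding jacobi_op_def pderiv_mult by (simp only: algebra_simps)
    thus ?thesis using pearson[of "pderiv p * q"] by (simp only: L_diff)
  qed
  show ?thesis using *[of p q] *[of q p] by (simp only: mult.commute)
qed

text \<open>The difference \<open>e\<close> of both sides has degree below \<open>n\<close>, and so has \<open>jacobi_op e\<close>. By symmetry
  \<open>e\<close> is therefore orthogonal to itself.\<close>
lemma jacobi_op_ortho: "jacobi_op (ortho n) = smult (eigenvalue n) (ortho n)"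
proof -
  define e where "e = jacobi_op (ortho n) - smult (eigenvalue n) (ortho n)"
  have e: "\<forall>k\<ge>n. coeff e k = 0"
    by (auto simp: e_def coeff_jacobi_op coeff_ortho_above le_less)
  hence De: "\<forall>k\<ge>n. coeff (jacobi_op e) k = 0"
    by (auto simp: coeff_jacobi_op)
  have "L (jacobi_op (ortho n) * e) = 0"
    unfolding jacobi_op_symmetric by (rule is_monic_orth_orth[OF is_monic_orth_ortho De])
  hence "L (e * e) = 0"
    using is_monic_orth_orth[OF is_monic_orth_ortho e]
    by (subst (1) e_def) (simp add: left_diff_distrib L_diff L_smult)
  hence "e = 0" using L_pos[of e] by force
  thus ?thesis by (simp add: e_def)
qed

text \<open>Comparing coefficients in the differential equation expresses each coefficient of the monic
  orthogonal polynomial through the two above it. The two coefficients below the leading one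
  determine the recurrence coefficients.\<close>
lemma coeff_ortho_rec:
  "(eigenvalue n - eigenvalue k) * coeff (ortho n) k =
     (\<beta> - \<alpha>) * (real k + 1) * coeff (ortho n) (k + 1) + (real k + 1) * (real k + 2) * coeff (ortho n) (k + 2)"
proof -
  have "coeff (jacobi_op (ortho n)) k = eigenvalue n * coeff (ortho n) k"
    by (simp add: jacobi_op_ortho)
  thus ?thesis unfolding coeff_jacobi_op by (simp add: algebra_simps)
qed

lemma coeff_ortho_1:
  "(2 * real n + \<alpha> + \<beta> + 2) * coeff (ortho (Suc n)) n = (\<alpha> - \<beta>) * (real n + 1)"
  using coeff_ortho_rec[of "Suc n" n]
  by (simp add: coeff_ortho_above eigenvalue_def algebra_simps)

lemma coeff_ortho_2:
  "2 * (2 * real n + \<alpha> + \<beta> + 3) * coeff (ortho (Suc (Suc n))) n =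
     (\<alpha> - \<beta>) * (real n + 1) * coeff (ortho (Suc (Suc n))) (Suc n) - (real n + 1) * (real n + 2)"
  using coeff_ortho_rec[of "Suc (Suc n)" n]
  by (simp add: eigenvalue_def algebra_simps)

lemma rec_a_coeff: "rec_a (Suc n) = coeff (ortho (Suc n)) n - coeff (ortho (Suc (Suc n))) (Suc n)"
  unfolding ortho_Suc_Suc by (simp add: coeff_ortho_above)

lemma rec_b_coeff:
  "rec_b (Suc (Suc n)) = coeff (ortho (Suc (Suc n))) n - coeff (ortho (Suc (Suc (Suc n)))) (Suc n)
     - rec_a (Suc (Suc n)) * coeff (ortho (Suc (Suc n))) (Suc n)"
  unfolding ortho_Suc_Suc[of "Suc n"] by (simp add: coeff_ortho_above)

lemma rec_a_eq:
  "rec_a (Suc n) = (\<beta>\<^sup>2 - \<alpha>\<^sup>2) / ((2 * real n + \<alpha> + \<beta> + 2) * (2 * real n + \<alpha> + \<beta> + 4))"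
proof -
  define m where "m = 2 * real n + \<alpha> + \<beta> + 2"
  have m: "m > 0" using \<alpha> \<beta> by (simp add: m_def)
  have n: "real n = (m - \<alpha> - \<beta> - 2) / 2" by (simp add: m_def)
  have 1: "coeff (ortho (Suc n)) n = (\<alpha> - \<beta>) * (real n + 1) / m"
    using coeff_ortho_1[of n] m by (simp add: m_def field_simps)
  have 2: "coeff (ortho (Suc (Suc n))) (Suc n) = (\<alpha> - \<beta>) * (real n + 2) / (m + 2)"
    using coeff_ortho_1[of "Suc n"] m by (simp add: m_def field_simps)
  have "rec_a (Suc n) = (\<beta>\<^sup>2 - \<alpha>\<^sup>2) / (m * (m + 2))"
    unfolding rec_a_coeff 1 2 n using m
    by (simp add: divide_simps) (simp add: algebra_simps power2_eq_square)
  thus ?thesis by (simp add: m_def algebra_simps)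
qed

text \<open>Written in \<open>m = 2 * k + \<alpha> + \<beta>\<close> for the coefficient of index \<open>k = n + 2\<close>, where \<open>m > 2\<close>, so
  that no denominator vanishes. At index \<open>1\<close> the factor \<open>m\<^sup>2 - 1\<close> can be \<open>0\<close>.\<close>
lemma rec_b_eq:
  fixes n :: nat
  defines "m \<equiv> 2 * real n + \<alpha> + \<beta> + 4"
  shows "rec_b (Suc (Suc n)) =
    (m\<^sup>2 - (\<alpha> + \<beta>)\<^sup>2) * (m\<^sup>2 - (\<alpha> - \<beta>)\<^sup>2) / (4 * m\<^sup>2 * (m\<^sup>2 - 1))"
proof -
  have m: "m > 2" using \<alpha> \<beta> by (simp add: m_def)
  have n: "real n = (m - \<alpha> - \<beta> - 4) / 2" by (simp add: m_def)
  have 1: "coeff (ortho (Suc (Suc n))) (Suc n) = (\<alpha> - \<beta>) * (real n + 2) / m"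
    using coeff_ortho_1[of "Suc n"] m by (simp add: m_def field_simps)
  have 2: "coeff (ortho (Suc (Suc (Suc n)))) (Suc (Suc n)) = (\<alpha> - \<beta>) * (real n + 3) / (m + 2)"
    using coeff_ortho_1[of "Suc (Suc n)"] m by (simp add: m_def field_simps)
  have 3: "coeff (ortho (Suc (Suc n))) n =
      ((\<alpha> - \<beta>) * (real n + 1) * ((\<alpha> - \<beta>) * (real n + 2) / m)
        - (real n + 1) * (real n + 2)) / (2 * (m - 1))"
  proof -
    have "2 * (m - 1) * coeff (ortho (Suc (Suc n))) n =
      (\<alpha> - \<beta>) * (real n + 1) * ((\<alpha> - \<beta>) * (real n + 2) / m) - (real n + 1) * (real n + 2)"
      using coeff_ortho_2[of n] unfolding 1 by (simp add: m_def algebra_simps)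
    thus ?thesis using m by (simp add: eq_divide_eq mult.commute)
  qed
  have 4: "coeff (ortho (Suc (Suc (Suc n)))) (Suc n) =
      ((\<alpha> - \<beta>) * (real n + 2) * ((\<alpha> - \<beta>) * (real n + 3) / (m + 2))
        - (real n + 2) * (real n + 3)) / (2 * (m + 1))"
  proof -
    have "2 * (m + 1) * coeff (ortho (Suc (Suc (Suc n)))) (Suc n) =
      (\<alpha> - \<beta>) * (real n + 2) * ((\<alpha> - \<beta>) * (real n + 3) / (m + 2)) - (real n + 2) * (real n + 3)"
      using coeff_ortho_2[of "Suc n"] unfolding 2 by (simp add: m_def algebra_simps)
    thus ?thesis using m by (simp add: eq_divide_eq mult.commute)
  qed
  have m1: "m\<^sup>2 - 1 = (m - 1) * (m + 1)" by (simp add: algebra_simps power2_eq_square)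
  have nz: "m \<noteq> 0" "m - 1 \<noteq> 0" "m + 1 \<noteq> 0" "m + 2 \<noteq> 0" using m by auto
  show ?thesis
    unfolding rec_b_coeff rec_a_coeff 1 2 3 4 n m1 using nz
    by (simp add: divide_simps) (simp add: algebra_simps power2_eq_square)
qed

text \<open>Both coefficients approach those of the free (Chebyshev) recurrence, \<open>0\<close> and \<open>1/4\<close>, at the
  rate \<open>1 / n\<^sup>2\<close>. The final asymptotics need a rate that is better than \<open>1 / n\<close>, since \<open>g\<close> itself
  is in general of that order.\<close>
lemma Bseq_rec_a: "Bseq (\<lambda>n. rec_a n * (real n + 1)\<^sup>2)"
proof -
  have "(\<lambda>n. (\<beta>\<^sup>2 - \<alpha>\<^sup>2) / ((2 * real n + \<alpha> + \<beta> + 2) * (2 * real n + \<alpha> + \<beta> + 4)) * (real n + 2)\<^sup>2)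
      \<longlonglongrightarrow> (\<beta>\<^sup>2 - \<alpha>\<^sup>2) / 4"
    by real_asymp
  hence "Bseq (\<lambda>n. (\<beta>\<^sup>2 - \<alpha>\<^sup>2) / ((2 * real n + \<alpha> + \<beta> + 2) * (2 * real n + \<alpha> + \<beta> + 4)) * (real n + 2)\<^sup>2)"
    by (intro convergent_imp_Bseq convergentI)
  hence "Bseq (\<lambda>n. rec_a (Suc n) * (real (Suc n) + 1)\<^sup>2)"
  proof -
    have "real (Suc n) + 1 = real n + 2" for n by simp
    thus ?thesis using \<open>Bseq _\<close> by (simp only: rec_a_eq)
  qed
  thus ?thesis by (subst (asm) Bseq_Suc_iff)
qed

lemma Bseq_rec_b: "Bseq (\<lambda>n. (rec_b n - 1/4) * (real n + 1)\<^sup>2)"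
proof -
  have "(\<lambda>n. (((2 * real n + \<alpha> + \<beta> + 4)\<^sup>2 - (\<alpha> + \<beta>)\<^sup>2) * ((2 * real n + \<alpha> + \<beta> + 4)\<^sup>2 - (\<alpha> - \<beta>)\<^sup>2)
      / (4 * (2 * real n + \<alpha> + \<beta> + 4)\<^sup>2 * ((2 * real n + \<alpha> + \<beta> + 4)\<^sup>2 - 1)) - 1/4) * (real n + 3)\<^sup>2)
      \<longlonglongrightarrow> (1 - (\<alpha> + \<beta>)\<^sup>2 - (\<alpha> - \<beta>)\<^sup>2) / 16"
    by real_asymp (simp add: field_simps power2_eq_square)
  hence "Bseq (\<lambda>n. (((2 * real n + \<alpha> + \<beta> + 4)\<^sup>2 - (\<alpha> + \<beta>)\<^sup>2) * ((2 * real n + \<alpha> + \<beta> + 4)\<^sup>2 - (\<alpha> - \<beta>)\<^sup>2)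
      / (4 * (2 * real n + \<alpha> + \<beta> + 4)\<^sup>2 * ((2 * real n + \<alpha> + \<beta> + 4)\<^sup>2 - 1)) - 1/4) * (real n + 3)\<^sup>2)"
    by (intro convergent_imp_Bseq convergentI)
  hence "Bseq (\<lambda>n. (rec_b (Suc (Suc n)) - 1/4) * (real (Suc (Suc n)) + 1)\<^sup>2)"
  proof -
    have "real (Suc (Suc n)) + 1 = real n + 3" for n by simp
    thus ?thesis using \<open>Bseq _\<close> by (simp only: rec_b_eq)
  qed
  hence "Bseq (\<lambda>n. (rec_b (Suc n) - 1/4) * (real (Suc n) + 1)\<^sup>2)"
    by (subst (asm) Bseq_Suc_iff)
  thus ?thesis by (subst (asm) Bseq_Suc_iff)
qed

end

section \<open>Distance to the interval and the Joukowski map\<close>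

definition dist_interval :: "complex \<Rightarrow> real" where
  "dist_interval z = infdist z (complex_of_real ` {-1..1})"

lemma dist_interval_le: "x \<in> {-1..1} \<Longrightarrow> dist_interval z \<le> cmod (z - of_real x)"
  unfolding dist_interval_def by (metis dist_norm image_eqI infdist_le)

text \<open>With \<open>r = R * u\<close> and \<open>u\<close> on the unit circle, the point \<open>Re u\<close> of the interval is obtained from
  \<open>z\<close> by replacing \<open>R\<close> with \<open>1\<close>. This moves \<open>z\<close> by at most \<open>R - 1\<close>.\<close>
lemma dist_interval_le_Joukowski:
  assumes "2 * z = r + 1 / r" "cmod r \<ge> 1"
  shows "dist_interval z \<le> cmod r - 1"
proof -
  define R where "R = cmod r"
  define u where "u = sgn r"
  have R: "R \<ge> 1" using assms by (simp add: R_def)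
  have "r \<noteq> 0" using assms(2) by auto
  hence r: "r = of_real R * u" by (simp add: R_def u_def sgn_eq)
  have u: "cmod u = 1" using \<open>r \<noteq> 0\<close> by (simp add: u_def norm_sgn)
  hence u1: "1 / u = cnj u"
    using complex_norm_square[of u] by (auto simp: divide_eq_eq mult.commute)
  have "2 * (z - of_real (Re u)) = of_real (R - 1) * u - of_real (1 - 1 / R) * cnj u"
  proof -
    have "2 * complex_of_real (Re u) = u + cnj u" by (simp add: complex_add_cnj)
    moreover have "1 / r = of_real (1 / R) * cnj u" unfolding r u1[symmetric] by simp
    ultimately show ?thesis using assms(1) r by (simp add: algebra_simps)
  qed
  hence "cmod (2 * (z - of_real (Re u))) \<le> cmod (of_real (R - 1) * u) + cmod (of_real (1 - 1 / R) * cnj u)"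
    by (simp only: norm_triangle_ineq4)
  hence "2 * cmod (z - of_real (Re u)) \<le> \<bar>R - 1\<bar> + \<bar>1 - 1 / R\<bar>"
    by (simp only: norm_mult norm_numeral norm_of_real complex_mod_cnj u mult_1_right)
  also have "\<bar>R - 1\<bar> + \<bar>1 - 1 / R\<bar> = (R - 1) + (1 - 1 / R)" using R by simp
  also have "\<dots> \<le> 2 * (R - 1)"
  proof -
    have "0 \<le> (R - 1)\<^sup>2 / R" using R by simp
    also have "(R - 1)\<^sup>2 / R = R - 2 + 1 / R" using R by (simp add: field_simps power2_eq_square)
    finally show ?thesis by simp
  qed
  finally have "cmod (z - of_real (Re u)) \<le> R - 1" by simp
  moreover have "Re u \<in> {-1..1}" using abs_Re_le_cmod[of u] u by auto
  ultimately show ?thesis using dist_interval_le[of "Re u" z] by (simp add: R_def)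
qed

text \<open>The two candidates \<open>z + s\<close> and \<open>z - s\<close> are reciprocal, so the one selected has modulus at
  least \<open>1\<close>. The previous lemma then makes this quantitative, and in particular excludes modulus
  \<open>1\<close> off the interval.\<close>
lemma rho_Joukowski:
  assumes "dist_interval z > 0"
  shows "2 * z = rho z + 1 / rho z" "cmod (rho z) \<ge> 1 + dist_interval z"
proof -
  define s where "s = csqrt (z\<^sup>2 - 1)"
  have prod: "(z + s) * (z - s) = 1"
    by (simp add: s_def algebra_simps flip: power2_eq_square)
  hence nz: "z + s \<noteq> 0" "z - s \<noteq> 0" by auto
  have inv: "1 / (z + s) = z - s" "1 / (z - s) = z + s"
    using prod nz by (auto simp: field_simps)
  have rho: "rho z = z + s \<or> rho z = z - s" by (auto simp: rho_def Let_def s_def)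
  thus 2: "2 * z = rho z + 1 / rho z" using inv by auto
  have "cmod (rho z) \<ge> 1"
  proof (cases "cmod (z + s) > 1")
    case True
    thus ?thesis by (simp add: rho_def Let_def s_def)
  next
    case False
    have "1 = cmod (z + s) * cmod (z - s)" using prod by (metis norm_mult norm_one)
    also have "\<dots> \<le> 1 * cmod (z - s)" using False by (intro mult_right_mono) auto
    finally show ?thesis using False by (simp add: rho_def Let_def s_def)
  qed
  thus "cmod (rho z) \<ge> 1 + dist_interval z"
    using dist_interval_le_Joukowski[OF 2] by simp
qed

text \<open>The complement of a neighbourhood of the interval is unbounded. This estimate is what keeps
  the later error bounds uniform near infinity: resolvent entries are bounded
  by \<open>1 / dist_interval z\<close>, which compensates a factor \<open>rho z\<close>.\<close>
lemma cmod_rho_le: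
  assumes d: "0 < d" "d \<le> dist_interval z"
  shows "cmod (rho z) \<le> (2 + 3 / d) * dist_interval z"
proof -
  have pos: "dist_interval z > 0" using d by simp
  have "compact (complex_of_real ` {-1..1})"
    by (intro compact_continuous_image continuous_intros compact_Icc)
  hence "closed (complex_of_real ` {-1..1})" "complex_of_real ` {-1..1} \<noteq> {}"
    by (simp_all add: compact_imp_closed)
  then obtain y where y: "y \<in> complex_of_real ` {-1..1}"
      "infdist z (complex_of_real ` {-1..1}) = dist z y"
    by (rule infdist_attains_inf)
  then obtain x where x: "x \<in> {-1..1}" "dist_interval z = cmod (z - of_real x)"
    by (auto simp: dist_interval_def dist_norm)
  have z: "cmod z \<le> dist_interval z + 1"
    using norm_triangle_sub[of z "of_real x"] x by auto
  have r1: "cmod (rho z) \<ge> 1" using rho_Joukowski(2)[OF pos] pos by simp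
  have "cmod (rho z) = cmod (2 * z - 1 / rho z)" using rho_Joukowski(1)[OF pos] by simp
  also have "\<dots> \<le> 2 * cmod z + 1 / cmod (rho z)"
    using norm_triangle_ineq4[of "2 * z" "1 / rho z"] by (simp add: norm_divide norm_mult)
  also have "1 / cmod (rho z) \<le> 1"
    using divide_le_eq_1_pos[of "cmod (rho z)" 1] r1 by linarith
  finally have "cmod (rho z) \<le> 2 * dist_interval z + 3" using z by simp
  also have "3 \<le> 3 / d * dist_interval z" using d by (simp add: field_simps)
  finally show ?thesis by (simp add: algebra_simps)
qed

lemma dist_interval_bounded_below:
  assumes "open U" "complex_of_real ` {-1..1} \<subseteq> U"
  obtains d where "d > 0" "\<And>z. z \<in> - U \<Longrightarrow> d \<le> dist_interval z"
proof -
  have c: "compact (complex_of_real ` {-1..1})"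
    by (intro compact_continuous_image continuous_intros compact_Icc)
  have "complex_of_real ` {-1..1} \<inter> - U = {}" "closed (- U)" using assms by auto
  from separate_compact_closed[OF c this(2,1)]
  obtain d where d: "d > 0" "\<forall>x\<in>complex_of_real ` {-1..1}. \<forall>y\<in>- U. d \<le> dist x y"
    by blast
  have "d \<le> dist_interval z" if "z \<in> - U" for z
  proof -
    have "complex_of_real ` {-1..1} \<noteq> {}" by simp
    thus ?thesis unfolding dist_interval_def infdist_notempty[OF \<open>_ \<noteq> {}\<close>]
      using d(2) that by (intro cINF_greatest) (auto simp: dist_commute)
  qed
  thus ?thesis using that d(1) by blast
qed

section \<open>The Jacobi integral and its Cauchy transform\<close>

definition supp_weight :: "real \<Rightarrow> real \<Rightarrow> real \<Rightarrow> real" where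
  "supp_weight \<alpha> \<beta> x = indicator {-1<..<1} x * jacobi_weight \<alpha> \<beta> x"

lemma jacobi_int_altdef: "jacobi_int \<alpha> \<beta> f = (\<integral>x. supp_weight \<alpha> \<beta> x *\<^sub>R f x \<partial>lborel)"
  unfolding jacobi_int_def set_lebesgue_integral_def supp_weight_def
  by (intro Bochner_Integration.integral_cong) (auto simp: mult_ac)

lemma weighted_cauchy_altdef:
  "weighted_cauchy \<alpha> \<beta> p z =
     (\<integral>x. supp_weight \<alpha> \<beta> x *\<^sub>R (of_real (poly p x) / (z - of_real x)) \<partial>lborel)"
  unfolding weighted_cauchy_def set_lebesgue_integral_def supp_weight_def
  by (intro Bochner_Integration.integral_cong) (auto simp: scaleR_conv_of_real mult_ac)

lemma supp_weight_nonneg: "supp_weight \<alpha> \<beta> x \<ge> 0"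
  by (simp add: supp_weight_def jacobi_weight_def)

text \<open>The affine map \<open>t = (1 + x) / 2\<close> carries the weight to the integrand of the Beta function.\<close>
lemma integrable_supp_weight:
  assumes "\<alpha> > -1" "\<beta> > -1"
  shows "integrable lborel (supp_weight \<alpha> \<beta>)"
proof -
  define f where "f = (\<lambda>t::real. t powr \<beta> * (1 - t) powr \<alpha>)"
  have "f integrable_on {0..1}"
    using has_integral_Beta_real[of "\<beta> + 1" "\<alpha> + 1"] assms
    unfolding f_def by (auto simp: integrable_on_def)
  hence "f absolutely_integrable_on {0..1}"
    by (rule nonnegative_absolutely_integrable_1) (simp add: f_def)
  hence "f absolutely_integrable_on {0<..<1}"
    by (rule set_integrable_subset) auto
  hence "integrable (completion lborel) (\<lambda>t. indicator {0<..<1} t *\<^sub>R f t)"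
    by (simp add: set_integrable_def)
  moreover have "(\<lambda>t. indicator {0<..<1} t *\<^sub>R f t) \<in> borel_measurable lborel"
    unfolding f_def by measurable
  ultimately have "integrable lborel (\<lambda>t. indicator {0<..<1} t *\<^sub>R f t)"
    by (subst (asm) integrable_completion)
  hence "integrable lborel (\<lambda>x. indicator {0<..<1} (1/2 + 1/2 * x) *\<^sub>R f (1/2 + 1/2 * x))"
    by (rule lborel_integrable_real_affine) simp
  hence "integrable lborel (\<lambda>x. 2 powr (\<alpha> + \<beta>) *
      (indicator {0<..<1} (1/2 + 1/2 * x) *\<^sub>R f (1/2 + 1/2 * x)))"
    by (rule integrable_mult_right)
  also have "(\<lambda>x. 2 powr (\<alpha> + \<beta>) *
      (indicator {0<..<1} (1/2 + 1/2 * x) *\<^sub>R f (1/2 + 1/2 * x))) = supp_weight \<alpha> \<beta>"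
  proof
    fix x :: real
    show "2 powr (\<alpha> + \<beta>) * (indicator {0<..<1} (1/2 + 1/2 * x) *\<^sub>R f (1/2 + 1/2 * x))
      = supp_weight \<alpha> \<beta> x"
    proof (cases "x \<in> {-1<..<1}")
      case True
      have eq: "1/2 + 1/2 * x = (1 + x) / 2" "1 - (1 + x) / 2 = (1 - x) / 2" by (simp_all add: field_simps)
      have "f (1/2 + 1/2 * x) = (1 + x) powr \<beta> / 2 powr \<beta> * ((1 - x) powr \<alpha> / 2 powr \<alpha>)"
        unfolding f_def eq using True by (simp add: powr_divide)
      thus ?thesis using True
        by (simp add: supp_weight_def jacobi_weight_def powr_add field_simps)
    qed (auto simp: supp_weight_def)
  qed
  finally show ?thesis .
qed

lemma integrable_supp_weight_mult:
  fixes F :: "real \<Rightarrow> 'a :: euclidean_space"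
  assumes "\<alpha> > -1" "\<beta> > -1" and F: "continuous_on {-1..1} F"
  shows "integrable lborel (\<lambda>x. supp_weight \<alpha> \<beta> x *\<^sub>R F x)"
proof -
  have "bounded (F ` {-1..1})"
    by (intro compact_imp_bounded compact_continuous_image F) auto
  then obtain B where B: "\<And>x. x \<in> {-1..1} \<Longrightarrow> norm (F x) \<le> B"
    unfolding bounded_iff by blast
  have w: "integrable lborel (supp_weight \<alpha> \<beta>)" using assms by (intro integrable_supp_weight)
  have eq: "(\<lambda>x. supp_weight \<alpha> \<beta> x *\<^sub>R F x) = (\<lambda>x. supp_weight \<alpha> \<beta> x *\<^sub>R (indicator {-1<..<1} x *\<^sub>R F x))"
    by (auto simp: supp_weight_def fun_eq_iff indicator_def)
  show ?thesis unfolding eq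
  proof (rule Bochner_Integration.integrable_bound)
    show "integrable lborel (\<lambda>x. B * supp_weight \<alpha> \<beta> x)" using w by simp
    have "(\<lambda>x. indicator {-1<..<1} x *\<^sub>R F x) \<in> borel_measurable borel"
      by (intro borel_measurable_continuous_on_indicator continuous_on_subset[OF F]) auto
    thus "(\<lambda>x. supp_weight \<alpha> \<beta> x *\<^sub>R (indicator {-1<..<1} x *\<^sub>R F x)) \<in> borel_measurable lborel"
      using borel_measurable_integrable[OF w] by measurable
    have "norm (supp_weight \<alpha> \<beta> x *\<^sub>R (indicator {-1<..<1} x *\<^sub>R F x)) \<le> norm (B * supp_weight \<alpha> \<beta> x)" for x
    proof (cases "x \<in> {-1<..<1}")
      case True
      hence "norm (F x) \<le> B" by (intro B) auto
      moreover have "norm (F x) \<le> \<bar>B\<bar>" using calculation by linarith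
      ultimately show ?thesis using True supp_weight_nonneg[of \<alpha> \<beta> x]
        by (simp add: abs_mult mult.commute[of _ "supp_weight \<alpha> \<beta> x"] mult_left_mono)
    qed simp
    thus "AE x in lborel. norm (supp_weight \<alpha> \<beta> x *\<^sub>R (indicator {-1<..<1} x *\<^sub>R F x))
        \<le> norm (B * supp_weight \<alpha> \<beta> x)" by simp
  qed
qed

lemma jacobi_int_square_pos:
  assumes "\<alpha> > -1" "\<beta> > -1" "p \<noteq> 0"
  shows "jacobi_int \<alpha> \<beta> (poly (p * p)) > 0"
proof -
  let ?f = "\<lambda>x. supp_weight \<alpha> \<beta> x *\<^sub>R poly (p * p) x"
  have int: "integrable lborel ?f"
    using assms by (intro integrable_supp_weight_mult continuous_intros)
  have nonneg: "?f x \<ge> 0" for x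
    using supp_weight_nonneg[of \<alpha> \<beta> x] by simp
  have "integral\<^sup>L lborel ?f \<noteq> 0"
  proof
    assume "integral\<^sup>L lborel ?f = 0"
    hence "AE x in lborel. ?f x = 0"
      using integral_nonneg_eq_0_iff_AE[OF int] nonneg by simp
    moreover have "finite {x. poly p x = 0}" by (rule poly_roots_finite[OF assms(3)])
    hence "AE x in lborel. x \<notin> {x. poly p x = 0}"
      by (intro AE_not_in finite_imp_null_set_lborel)
    ultimately have "AE x in lborel. x \<notin> {-1<..<1::real}"
      by eventually_elim (auto simp: supp_weight_def jacobi_weight_def)
    hence "emeasure lborel {-1<..<1::real} = 0"
      using AE_iff_measurable[of "{-1<..<1}" lborel "\<lambda>x. x \<notin> {-1<..<1::real}"]
      by (simp add: set_eq_iff)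
    thus False by simp
  qed
  moreover have "integral\<^sup>L lborel ?f \<ge> 0" using nonneg by (intro integral_nonneg_AE) auto
  ultimately show ?thesis unfolding jacobi_int_altdef by linarith
qed

text \<open>The integrand is the derivative of \<open>(1 - x) powr (\<alpha> + 1) * (1 + x) powr (\<beta> + 1) * p\<close>, which
  vanishes at both endpoints because the exponents are positive.\<close>
lemma jacobi_int_pearson:
  assumes "\<alpha> > -1" "\<beta> > -1"
  shows "jacobi_int \<alpha> \<beta> (poly ([:1, 0, -1:] * pderiv p + [:\<beta> - \<alpha>, - (\<alpha> + \<beta> + 2):] * p)) = 0"
proof -
  define F where "F = (\<lambda>x. (1 - x) powr (\<alpha> + 1) * (1 + x) powr (\<beta> + 1) * poly p x)"
  define q where "q = [:1, 0, -1:] * pderiv p + [:\<beta> - \<alpha>, - (\<alpha> + \<beta> + 2):] * p"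
  define f where "f = (\<lambda>x. poly q x * jacobi_weight \<alpha> \<beta> x)"
  have contF: "continuous_on {-1..1} F"
    unfolding F_def using assms by (intro continuous_intros continuous_on_powr') auto
  have deriv: "(F has_real_derivative f x) (at x)" if "-1 < x" "x < 1" for x
  proof -
    have pw: "(1 - x) powr (\<alpha> + 1) = (1 - x) * (1 - x) powr \<alpha>"
      "(1 + x) powr (\<beta> + 1) = (1 + x) * (1 + x) powr \<beta>"
      using that by (simp_all add: powr_add)
    have "(F has_real_derivative
       (((\<alpha> + 1) * (1 - x) powr \<alpha> * (-1)) * (1 + x) powr (\<beta> + 1)
         + (1 - x) powr (\<alpha> + 1) * ((\<beta> + 1) * (1 + x) powr \<beta>)) * poly p x
       + (1 - x) powr (\<alpha> + 1) * (1 + x) powr (\<beta> + 1) * poly (pderiv p) x) (at x)"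
      unfolding F_def using that by (auto intro!: derivative_eq_intros)
    also have "(((\<alpha> + 1) * (1 - x) powr \<alpha> * (-1)) * (1 + x) powr (\<beta> + 1)
         + (1 - x) powr (\<alpha> + 1) * ((\<beta> + 1) * (1 + x) powr \<beta>)) * poly p x
       + (1 - x) powr (\<alpha> + 1) * (1 + x) powr (\<beta> + 1) * poly (pderiv p) x = f x"
      unfolding pw by (simp add: f_def q_def jacobi_weight_def algebra_simps)
    finally show ?thesis .
  qed
  have "(LBINT x=ereal (-1)..ereal 1. f x) = 0 - 0"
  proof (rule interval_integral_FTC_integrable)
    show "(F has_vector_derivative f x) (at x)" if "ereal (-1) < ereal x" "ereal x < ereal 1" for x
      using deriv[of x] that by (simp add: has_real_derivative_iff_has_vector_derivative)
    show "isCont f x" if "ereal (-1) < ereal x" "ereal x < ereal 1" for x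
      unfolding f_def jacobi_weight_def using that by (auto intro!: continuous_intros)
    have "integrable lborel (\<lambda>x. supp_weight \<alpha> \<beta> x *\<^sub>R poly q x)"
      using assms by (intro integrable_supp_weight_mult continuous_intros)
    thus "set_integrable lborel (einterval (ereal (-1)) (ereal 1)) f"
      by (simp add: set_integrable_def supp_weight_def f_def mult_ac)
    have 0: "F (-1) = 0" "F 1 = 0" using assms by (auto simp: F_def)
    have "(F \<longlongrightarrow> F (-1)) (at_right (-1))"
      using contF by (simp add: continuous_on_Icc_at_rightD)
    thus "((F \<circ> real_of_ereal) \<longlongrightarrow> 0) (at_right (ereal (-1)))"
      by (simp add: ereal_tendsto_simps1 0)
    have "(F \<longlongrightarrow> F 1) (at_left 1)"
      using contF by (simp add: continuous_on_Icc_at_leftD)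
    thus "((F \<circ> real_of_ereal) \<longlongrightarrow> 0) (at_left (ereal 1))"
      by (simp add: ereal_tendsto_simps1 0)
  qed auto
  thus ?thesis
    unfolding jacobi_int_def q_def[symmetric] by (simp add: interval_integral_Ioo f_def)
qed

lemma jacobi_functional_jacobi_int:
  assumes "\<alpha> > -1" "\<beta> > -1"
  shows "jacobi_functional (\<lambda>p. jacobi_int \<alpha> \<beta> (poly p)) \<alpha> \<beta>"
proof unfold_locales
  fix p q :: "real poly" and c :: real
  have int: "integrable lborel (\<lambda>x. supp_weight \<alpha> \<beta> x *\<^sub>R poly p x)" for p
    using assms by (intro integrable_supp_weight_mult continuous_intros)
  show "jacobi_int \<alpha> \<beta> (poly (p + q)) = jacobi_int \<alpha> \<beta> (poly p) + jacobi_int \<alpha> \<beta> (poly q)"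
    using Bochner_Integration.integral_add[OF int[of p] int[of q]]
    by (simp add: jacobi_int_altdef distrib_left)
  show "jacobi_int \<alpha> \<beta> (poly (smult c p)) = c * jacobi_int \<alpha> \<beta> (poly p)"
    unfolding jacobi_int_altdef poly_smult integral_mult_right_zero[symmetric]
    by (intro Bochner_Integration.integral_cong) simp_all
qed (use assms jacobi_int_square_pos jacobi_int_pearson in auto)

text \<open>For fixed \<open>z\<close> off the interval, \<open>p \<mapsto> weighted_cauchy \<alpha> \<beta> p z\<close> is a linear functional on
  polynomials. The following properties are all that is used about it.\<close>
context
  fixes \<alpha> \<beta> :: real and z :: complex
  assumes \<alpha>: "\<alpha> > -1" and \<beta>: "\<beta> > -1" and z: "dist_interval z > 0"
begin

lemma off_interval_diff_nonzero: "x \<in> {-1..1} \<Longrightarrow> z - of_real x \<noteq> 0"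
  using dist_interval_le[of x z] z by auto

lemma integrable_cauchy:
  "integrable lborel (\<lambda>x. supp_weight \<alpha> \<beta> x *\<^sub>R (of_real (poly p x) / (z - of_real x)))"
  using \<alpha> \<beta> off_interval_diff_nonzero by (intro integrable_supp_weight_mult continuous_intros) auto

lemma weighted_cauchy_add:
  "weighted_cauchy \<alpha> \<beta> (p + q) z = weighted_cauchy \<alpha> \<beta> p z + weighted_cauchy \<alpha> \<beta> q z"
  using Bochner_Integration.integral_add[OF integrable_cauchy[of p] integrable_cauchy[of q]]
  by (simp add: weighted_cauchy_altdef scaleR_add_right add_divide_distrib)

lemma weighted_cauchy_smult:
  "weighted_cauchy \<alpha> \<beta> (smult c p) z = of_real c * weighted_cauchy \<alpha> \<beta> p z"
  unfolding weighted_cauchy_altdef integral_mult_right_zero[symmetric]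
  by (intro Bochner_Integration.integral_cong) (simp_all add: scaleR_conv_of_real)

text \<open>This is \<open>(z - x) / (z - x) = 1\<close> under the integral. It transports the three-term recurrence to
  functions of the second kind.\<close>
lemma weighted_cauchy_shift:
  "z * weighted_cauchy \<alpha> \<beta> p z - weighted_cauchy \<alpha> \<beta> (pCons 0 p) z = of_real (jacobi_int \<alpha> \<beta> (poly p))"
proof -
  have "z * weighted_cauchy \<alpha> \<beta> p z - weighted_cauchy \<alpha> \<beta> (pCons 0 p) z =
     (\<integral>x. z * (supp_weight \<alpha> \<beta> x *\<^sub>R (of_real (poly p x) / (z - of_real x)))
        - supp_weight \<alpha> \<beta> x *\<^sub>R (of_real (poly (pCons 0 p) x) / (z - of_real x)) \<partial>lborel)"
    unfolding weighted_cauchy_altdef integral_mult_right_zero[symmetric]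
    by (intro Bochner_Integration.integral_diff[symmetric] integrable_mult_right integrable_cauchy)
  also have "\<dots> = (\<integral>x. of_real (supp_weight \<alpha> \<beta> x *\<^sub>R poly p x) \<partial>lborel)"
  proof (rule Bochner_Integration.integral_cong)
    fix x
    show "z * (supp_weight \<alpha> \<beta> x *\<^sub>R (of_real (poly p x) / (z - of_real x)))
        - supp_weight \<alpha> \<beta> x *\<^sub>R (of_real (poly (pCons 0 p) x) / (z - of_real x))
       = of_real (supp_weight \<alpha> \<beta> x *\<^sub>R poly p x)"
    proof (cases "x \<in> {-1<..<1}")
      case True
      hence "z - of_real x \<noteq> 0" using off_interval_diff_nonzero[of x] by auto
      moreover have "z * (W * (P / D)) - W * (y * P / D) = W * P * ((z - y) / D)" for W P y D
        by (simp add: algebra_simps diff_divide_distrib)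
      ultimately show ?thesis by (simp add: scaleR_conv_of_real)
    qed (simp add: supp_weight_def)
  qed simp
  finally show ?thesis unfolding jacobi_int_altdef by (simp only: integral_complex_of_real)
qed

text \<open>The inequality between arithmetic and geometric mean in place of Cauchy-Schwarz: optimising
  the parameter \<open>s\<close> gives the product of the two norms.\<close>
lemma norm_weighted_cauchy_mult_le:
  assumes "s > 0"
  shows "cmod (weighted_cauchy \<alpha> \<beta> (p * q) z) \<le>
     (s * jacobi_int \<alpha> \<beta> (poly (p * p)) + jacobi_int \<alpha> \<beta> (poly (q * q)) / s) / (2 * dist_interval z)"
proof -
  have int: "integrable lborel (\<lambda>x. supp_weight \<alpha> \<beta> x *\<^sub>R poly p x)" for p
    using \<alpha> \<beta> by (intro integrable_supp_weight_mult continuous_intros)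
  define r where "r = smult (1 / (2 * dist_interval z)) (smult s (p * p) + smult (1 / s) (q * q))"
  have "cmod (weighted_cauchy \<alpha> \<beta> (p * q) z) \<le> (\<integral>x. supp_weight \<alpha> \<beta> x *\<^sub>R poly r x \<partial>lborel)"
    unfolding weighted_cauchy_altdef
  proof (rule Bochner_Integration.integral_norm_bound_integral[OF integrable_cauchy int])
    fix x
    show "norm (supp_weight \<alpha> \<beta> x *\<^sub>R (of_real (poly (p * q) x) / (z - of_real x)))
        \<le> supp_weight \<alpha> \<beta> x *\<^sub>R poly r x"
    proof (cases "x \<in> {-1<..<1}")
      case True
      have "0 \<le> (s * \<bar>poly p x\<bar> - \<bar>poly q x\<bar>)\<^sup>2 / s" using assms by simp
      also have "\<dots> = s * (poly p x)\<^sup>2 + (poly q x)\<^sup>2 / s - 2 * \<bar>poly p x * poly q x\<bar>"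
        using assms by (simp add: power2_eq_square field_simps abs_mult)
      finally have "\<bar>poly p x * poly q x\<bar> \<le> (s * (poly p x)\<^sup>2 + (poly q x)\<^sup>2 / s) / 2" by simp
      moreover have "dist_interval z \<le> cmod (z - of_real x)"
        using True by (intro dist_interval_le) auto
      ultimately have "\<bar>poly p x * poly q x\<bar> / cmod (z - of_real x)
          \<le> (s * (poly p x)\<^sup>2 + (poly q x)\<^sup>2 / s) / 2 / dist_interval z"
        using z by (intro frac_le) auto
      hence "norm (of_real (poly (p * q) x) / (z - of_real x)) \<le> poly r x"
        by (simp add: r_def norm_divide norm_mult abs_mult power2_eq_square field_simps)
      thus ?thesis using supp_weight_nonneg[of \<alpha> \<beta> x] by (simp add: mult_left_mono)
    qed (simp add: supp_weight_def)
  qed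
  also have "(\<integral>x. supp_weight \<alpha> \<beta> x *\<^sub>R poly r x \<partial>lborel) = jacobi_int \<alpha> \<beta> (poly r)"
    by (simp add: jacobi_int_altdef)
  also have "\<dots> = (s * jacobi_int \<alpha> \<beta> (poly (p * p)) + jacobi_int \<alpha> \<beta> (poly (q * q)) / s) / (2 * dist_interval z)"
  proof -
    interpret jacobi_functional "\<lambda>p. jacobi_int \<alpha> \<beta> (poly p)" \<alpha> \<beta>
      using \<alpha> \<beta> by (rule jacobi_functional_jacobi_int)
    show ?thesis unfolding r_def L_smult L_add by simp
  qed
  finally show ?thesis .
qed

end

section \<open>Comparison with the free Jacobi matrix\<close>

text \<open>Summation by parts for the free operator \<open>m \<mapsto> z * m k - (m (k + 1) + m (k - 1)) / 2\<close>.\<close>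
lemma discrete_green_identity:
  fixes y m :: "nat \<Rightarrow> complex"
  shows "(\<Sum>k=1..K. y k * (z * m k - (m (k + 1) + m (k - 1)) / 2)) =
     (\<Sum>k=1..K. m k * (z * y k - (y (k + 1) + y (k - 1)) / 2))
     + (y (K + 1) * m K - y K * m (K + 1) + y 0 * m 1 - y 1 * m 0) / 2"
proof (induction K)
  case (Suc K)
  have step: "y (Suc K) * (z * m (Suc K) - (m (Suc K + 1) + m (Suc K - 1)) / 2) =
      m (Suc K) * (z * y (Suc K) - (y (Suc K + 1) + y (Suc K - 1)) / 2)
      + (y (Suc K + 1) * m (Suc K) - y (Suc K) * m (Suc K + 1)
         - (y (K + 1) * m K - y K * m (K + 1))) / 2"
    by (simp add: field_simps)
  have cl: "sum f {1..Suc K} = sum f {1..K} + f (Suc K)" for f :: "nat \<Rightarrow> complex"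
    by simp
  have regroup: "(S + (u + d - e) / 2) + (t + (v - u) / 2) = (S + t) + (v + d - e) / 2"
    for S t u v d e :: complex
    by (simp add: field_simps)
  show ?case unfolding cl Suc.IH step by (rule regroup)
qed simp

text \<open>Up to the factor \<open>z - \<sigma>\<close>, the powers \<open>\<sigma> ^ \<bar>k - p\<bar>\<close> form the resolvent of the free operator
  on the whole line. The exponent is written with truncated subtraction, where one of the two
  summands is always \<open>0\<close>.\<close>
lemma free_kernel:
  fixes \<sigma> :: complex and p k :: nat
  assumes "2 * z = \<sigma> + 1 / \<sigma>" "\<sigma> \<noteq> 0" "k \<ge> 1"
  defines "y \<equiv> \<lambda>k. \<sigma> ^ ((k - p) + (p - k))"
  shows "z * y k - (y (k + 1) + y (k - 1)) / 2 = (if k = p then z - \<sigma> else 0)"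
proof -
  have z: "z = (\<sigma> + 1 / \<sigma>) / 2" using assms(1) by (metis nonzero_mult_div_cancel_left zero_neq_numeral)
  consider j where "k = p + Suc j" | j where "p = k + Suc j" | "k = p"
    by (metis less_imp_Suc_add linorder_less_linear add_Suc_right)
  thus ?thesis
  proof cases
    case (1 j)
    hence "y k = \<sigma> * \<sigma> ^ j" "y (k + 1) = \<sigma> * \<sigma> * \<sigma> ^ j" "y (k - 1) = \<sigma> ^ j" by (simp_all add: y_def)
    thus ?thesis using 1 assms(2) by (simp add: z field_simps)
  next
    case (2 j)
    hence "y k = \<sigma> * \<sigma> ^ j" "y (k + 1) = \<sigma> ^ j" "y (k - 1) = \<sigma> * \<sigma> * \<sigma> ^ j"
      using assms(3) by (simp_all add: y_def Suc_diff_le)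
    thus ?thesis using 2 assms(2) by (simp add: z field_simps)
  next
    case 3
    hence "y k = 1" "y (k + 1) = \<sigma>" "y (k - 1) = \<sigma>" using assms(3) by (simp_all add: y_def)
    thus ?thesis using 3 by simp
  qed
qed

lemma summable_power_times_square:
  fixes \<kappa> :: real assumes "0 \<le> \<kappa>" "\<kappa> < 1"
  shows "summable (\<lambda>j. \<kappa> ^ j * (real j + 1)\<^sup>2)"
proof -
  have "(\<lambda>j. \<kappa> * ((real j + 2) / (real j + 1))\<^sup>2) \<longlonglongrightarrow> \<kappa> * 1\<^sup>2"
    by (intro tendsto_intros) real_asymp
  moreover have "\<kappa> * 1\<^sup>2 < (1 + \<kappa>) / 2" using assms by simp
  ultimately have "\<forall>\<^sub>F j in sequentially. \<kappa> * ((real j + 2) / (real j + 1))\<^sup>2 < (1 + \<kappa>) / 2"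
    by (rule order_tendstoD)
  then obtain N where N: "\<And>j. j \<ge> N \<Longrightarrow> \<kappa> * ((real j + 2) / (real j + 1))\<^sup>2 < (1 + \<kappa>) / 2"
    by (auto simp: eventually_at_top_linorder)
  show ?thesis
  proof (rule summable_ratio_test)
    show "(1 + \<kappa>) / 2 < 1" using assms by simp
    fix j assume "j \<ge> N"
    have "\<kappa> ^ Suc j * (real (Suc j) + 1)\<^sup>2 =
        (\<kappa> * ((real j + 2) / (real j + 1))\<^sup>2) * (\<kappa> ^ j * (real j + 1)\<^sup>2)"
      by (simp add: power_divide add.commute)
    also have "\<dots> \<le> (1 + \<kappa>) / 2 * (\<kappa> ^ j * (real j + 1)\<^sup>2)"
      using N[OF \<open>j \<ge> N\<close>] assms by (intro mult_right_mono) auto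
    finally show "norm (\<kappa> ^ Suc j * (real (Suc j) + 1)\<^sup>2)
        \<le> (1 + \<kappa>) / 2 * norm (\<kappa> ^ j * (real j + 1)\<^sup>2)"
      using assms by simp
  qed
qed

text \<open>Convolution with a geometric kernel preserves the decay \<open>1 / k\<^sup>2\<close>: from
  \<open>p + 1 \<le> (k + 1) * (\<bar>k - p\<bar> + 1)\<close> the weight \<open>1 / (k + 1)\<^sup>2\<close> is at most
  \<open>(\<bar>k - p\<bar> + 1)\<^sup>2 / (p + 1)\<^sup>2\<close>, and the numerator is absorbed by the geometric factor.\<close>
lemma geometric_convolution_bound:
  fixes \<kappa> :: real assumes \<kappa>: "0 \<le> \<kappa>" "\<kappa> < 1"
  defines "S \<equiv> suminf (\<lambda>j. \<kappa> ^ j * (real j + 1)\<^sup>2)"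
  shows "(\<Sum>k=1..K. \<kappa> ^ ((k - p) + (p - k)) / (real k + 1)\<^sup>2) \<le> 2 * S / (real p + 1)\<^sup>2"
proof -
  define f where "f = (\<lambda>j. \<kappa> ^ j * (real j + 1)\<^sup>2)"
  have f0: "f j \<ge> 0" for j using \<kappa> by (simp add: f_def)
  have sf: "sum f A \<le> S" if "finite A" for A
    unfolding S_def using that summable_power_times_square[OF \<kappa>] f0
    by (fold f_def) (rule sum_le_suminf, auto)
  have term_le: "\<kappa> ^ ((k - p) + (p - k)) / (real k + 1)\<^sup>2 \<le> f ((k - p) + (p - k)) / (real p + 1)\<^sup>2" for k
  proof -
    define j where "j = (k - p) + (p - k)"
    have "p + 1 \<le> (k + 1) * (j + 1)" by (simp add: j_def)
    hence "real (p + 1) \<le> real ((k + 1) * (j + 1))" by (rule of_nat_mono)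
    hence "real p + 1 \<le> (real k + 1) * (real j + 1)" by (simp add: algebra_simps)
    hence "(real p + 1)\<^sup>2 \<le> ((real k + 1) * (real j + 1))\<^sup>2" by (intro power_mono) auto
    hence "\<kappa> ^ j * (real p + 1)\<^sup>2 \<le> \<kappa> ^ j * ((real k + 1) * (real j + 1))\<^sup>2"
      using \<kappa> by (intro mult_left_mono) auto
    thus ?thesis unfolding j_def[symmetric] f_def
      by (simp add: divide_simps power_mult_distrib mult_ac)
  qed
  have "(\<Sum>k=1..K. \<kappa> ^ ((k - p) + (p - k)) / (real k + 1)\<^sup>2)
      \<le> (\<Sum>k=1..K. f ((k - p) + (p - k))) / (real p + 1)\<^sup>2"
    unfolding sum_divide_distrib by (intro sum_mono term_le)
  also have "(\<Sum>k=1..K. f ((k - p) + (p - k))) \<le> (\<Sum>k\<in>{..p} \<union> {p..K}. f ((k - p) + (p - k)))"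
    using f0 by (intro sum_mono2) auto
  also have "\<dots> \<le> (\<Sum>k\<in>{..p}. f ((k - p) + (p - k))) + (\<Sum>k\<in>{p..K}. f ((k - p) + (p - k)))"
    using f0 by (subst sum_Un) (auto intro!: sum_nonneg)
  also have "(\<Sum>k\<in>{..p}. f ((k - p) + (p - k))) = sum f ((\<lambda>k. p - k) ` {..p})"
    by (subst sum.reindex) (auto simp: inj_on_def)
  also have "(\<Sum>k\<in>{p..K}. f ((k - p) + (p - k))) = sum f ((\<lambda>k. k - p) ` {p..K})"
    by (subst sum.reindex) (auto simp: inj_on_def)
  also have "sum f ((\<lambda>k. p - k) ` {..p}) + sum f ((\<lambda>k. k - p) ` {p..K}) \<le> 2 * S"
    using sf[of "(\<lambda>k. p - k) ` {..p}"] sf[of "(\<lambda>k. k - p) ` {p..K}"] by simp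
  finally show ?thesis by (simp add: divide_right_mono)
qed

text \<open>A bounded column \<open>m\<close> of the resolvent of a Jacobi matrix with diagonal \<open>a\<close> and off-diagonal \<open>c\<close>
  satisfies the free equation up to the error \<open>e\<close>, of size \<open>B * E / k\<^sup>2\<close>. Summing against the free
  kernel centred at \<open>p\<close> isolates \<open>m p\<close>. What remains is a geometric convolution of \<open>e\<close> and
  boundary terms, which are exponentially small in \<open>p\<close>. The only information needed about \<open>m\<close> is the
  uniform bound \<open>B\<close>, because the exponential decay is that of the free kernel, and the constant depends
  on \<open>z\<close> only through \<open>B\<close> and the bound \<open>\<kappa>\<close> on \<open>\<sigma>\<close>.\<close>
lemma perturbed_resolvent:
  fixes m :: "nat \<Rightarrow> complex" and a c :: "nat \<Rightarrow> real" and \<kappa> B E :: real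
  assumes rec: "\<And>k. k \<ge> 1 \<Longrightarrow> (z - of_real (a k)) * m k - of_real (c (k + 1)) * m (k + 1)
       - of_real (c k) * m (k - 1) = (if k = n then 1 else 0)"
    and m: "\<And>k. cmod (m k) \<le> B"
    and a: "\<And>k. \<bar>a k\<bar> \<le> E / (real k + 1)\<^sup>2"
    and c: "\<And>k. \<bar>c k - 1/2\<bar> \<le> E / (real k + 1)\<^sup>2"
    and \<sigma>: "2 * z = \<sigma> + 1 / \<sigma>" "\<sigma> \<noteq> 0" "cmod \<sigma> \<le> \<kappa>" and \<kappa>: "0 < \<kappa>" "\<kappa> < 1"
    and np: "n \<ge> 1" "p \<ge> 1"
  defines "S \<equiv> suminf (\<lambda>j. \<kappa> ^ j * (real j + 1)\<^sup>2)"
  shows "cmod (m p * (z - \<sigma>) - \<sigma> ^ ((n - p) + (p - n))) \<le> B * S * (6 * E + 2 / \<kappa>) / (real p + 1)\<^sup>2"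
proof -
  define y where "y = (\<lambda>k. \<sigma> ^ ((k - p) + (p - k)))"
  define e where "e = (\<lambda>k. of_real (a k) * m k + of_real (c (k + 1) - 1/2) * m (k + 1)
     + of_real (c k - 1/2) * m (k - 1))"
  \<comment> \<open>The sums run to \<open>K\<close>, far enough beyond \<open>p\<close> for the boundary term there to be as small as the
    one at \<open>0\<close>, and beyond \<open>n\<close> so that the source term is included.\<close>
  define K where "K = 2 * p + n"
  have B: "B \<ge> 0" using m[of 0] norm_ge_zero order_trans by blast
  have E: "E \<ge> 0" using a[of 0] by simp
  have S: "\<kappa> ^ j * (real j + 1)\<^sup>2 \<le> S" for j
  proof -
    have "sum (\<lambda>j. \<kappa> ^ j * (real j + 1)\<^sup>2) {j} \<le> S"
      unfolding S_def using summable_power_times_square[of \<kappa>] \<kappa> by (intro sum_le_suminf) auto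
    thus ?thesis by simp
  qed
  have e_bound: "cmod (e k) \<le> 3 * B * E / (real k + 1)\<^sup>2" for k
  proof -
    have ck: "\<bar>c (k + 1) - 1/2\<bar> \<le> E / (real k + 1)\<^sup>2"
    proof (rule order_trans[OF c])
      show "E / (real (k + 1) + 1)\<^sup>2 \<le> E / (real k + 1)\<^sup>2"
        using E by (intro divide_left_mono power_mono) auto
    qed
    have *: "cmod (of_real x * m j) \<le> E / (real k + 1)\<^sup>2 * B" if "\<bar>x\<bar> \<le> E / (real k + 1)\<^sup>2" for x j
      unfolding norm_mult norm_of_real using that m[of j] E by (intro mult_mono) auto
    have "cmod (e k) \<le> E / (real k + 1)\<^sup>2 * B + E / (real k + 1)\<^sup>2 * B + E / (real k + 1)\<^sup>2 * B"
      unfolding e_def by (intro norm_triangle_mono * a ck c)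
    thus ?thesis by (simp add: algebra_simps)
  qed
  have free: "z * m k - (m (k + 1) + m (k - 1)) / 2 = (if k = n then 1 else 0) + e k" if "k \<ge> 1" for k
    using rec[OF that] by (simp add: e_def algebra_simps split: if_splits)
  have "(\<Sum>k=1..K. y k * ((if k = n then 1 else 0) + e k))
      = (\<Sum>k=1..K. y k * (z * m k - (m (k + 1) + m (k - 1)) / 2))"
    by (intro sum.cong refl, subst free) simp_all
  also have "\<dots> = (\<Sum>k=1..K. m k * (z * y k - (y (k + 1) + y (k - 1)) / 2))
     + (y (K + 1) * m K - y K * m (K + 1) + y 0 * m 1 - y 1 * m 0) / 2"
    by (rule discrete_green_identity)
  also have "(\<Sum>k=1..K. m k * (z * y k - (y (k + 1) + y (k - 1)) / 2))
      = (\<Sum>k=1..K. if k = p then m p * (z - \<sigma>) else 0)"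
    unfolding y_def by (intro sum.cong refl) (subst free_kernel[OF \<sigma>(1,2)], auto)
  also have "\<dots> = m p * (z - \<sigma>)"
    using np by (simp add: K_def)
  also have "(\<Sum>k=1..K. y k * ((if k = n then 1 else 0) + e k)) = y n + (\<Sum>k=1..K. y k * e k)"
  proof -
    have "(\<Sum>k=1..K. y k * (if k = n then 1 else 0)) = (\<Sum>k=1..K. if k = n then y n else 0)"
      by (intro sum.cong) auto
    also have "\<dots> = y n" using np by (simp add: K_def)
    finally show ?thesis by (simp add: distrib_left sum.distrib)
  qed
  finally have main: "m p * (z - \<sigma>) - y n = (\<Sum>k=1..K. y k * e k)
     - (y (K + 1) * m K - y K * m (K + 1) + y 0 * m 1 - y 1 * m 0) / 2"
    by (simp add: algebra_simps)
  have y_le: "cmod (y k) \<le> \<kappa> ^ ((k - p) + (p - k))" for k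
    unfolding y_def norm_power using \<sigma>(3) by (intro power_mono) auto
  have "cmod (\<Sum>k=1..K. y k * e k) \<le> (\<Sum>k=1..K. \<kappa> ^ ((k - p) + (p - k)) * (3 * B * E / (real k + 1)\<^sup>2))"
  proof (intro sum_norm_le)
    fix k
    show "cmod (y k * e k) \<le> \<kappa> ^ ((k - p) + (p - k)) * (3 * B * E / (real k + 1)\<^sup>2)"
      unfolding norm_mult using \<kappa> by (intro mult_mono y_le e_bound) auto
  qed
  also have "\<dots> = 3 * B * E * (\<Sum>k=1..K. \<kappa> ^ ((k - p) + (p - k)) / (real k + 1)\<^sup>2)"
    by (simp add: sum_distrib_left mult_ac)
  also have "\<dots> \<le> 3 * B * E * (2 * S / (real p + 1)\<^sup>2)"
    unfolding S_def using \<kappa> B E by (intro mult_left_mono geometric_convolution_bound) auto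
  finally have 1: "cmod (\<Sum>k=1..K. y k * e k) \<le> 3 * B * E * (2 * S / (real p + 1)\<^sup>2)" .
  have bd: "cmod (y j * m i) \<le> S / \<kappa> / (real p + 1)\<^sup>2 * B" if "p - 1 \<le> (j - p) + (p - j)" for i j
  proof -
    have "cmod (y j) \<le> \<kappa> ^ (p - 1)"
      by (rule order_trans[OF y_le power_decreasing[OF that]]) (use \<kappa> in auto)
    also have "\<dots> = \<kappa> ^ p / \<kappa>" using np \<kappa> by (simp add: power_diff)
    also have "\<dots> \<le> S / \<kappa> / (real p + 1)\<^sup>2"
      using S[of p] \<kappa> by (simp add: field_simps)
    finally have "cmod (y j) \<le> S / \<kappa> / (real p + 1)\<^sup>2" .
    thus ?thesis unfolding norm_mult using m[of i] norm_ge_zero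
      by (intro mult_mono) (auto intro: order_trans[OF norm_ge_zero])
  qed
  have "cmod (y (K + 1) * m K - y K * m (K + 1) + y 0 * m 1 - y 1 * m 0)
     \<le> S / \<kappa> / (real p + 1)\<^sup>2 * B + S / \<kappa> / (real p + 1)\<^sup>2 * B
       + S / \<kappa> / (real p + 1)\<^sup>2 * B + S / \<kappa> / (real p + 1)\<^sup>2 * B"
  proof -
    have four: "cmod (u1 - u2 + u3 - u4) \<le> r + r + r + r"
      if "cmod u1 \<le> r" "cmod u2 \<le> r" "cmod u3 \<le> r" "cmod u4 \<le> r" for u1 u2 u3 u4 r
      using that norm_triangle_ineq4[of "u1 - u2 + u3" u4] norm_triangle_ineq[of "u1 - u2" u3]
        norm_triangle_ineq4[of u1 u2] by linarith
    show ?thesis using np by (intro four bd) (auto simp: K_def)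
  qed
  hence 2: "cmod ((y (K + 1) * m K - y K * m (K + 1) + y 0 * m 1 - y 1 * m 0) / 2)
      \<le> 2 * (S / \<kappa> / (real p + 1)\<^sup>2 * B)"
    by (simp add: norm_divide mult_ac)
  have "cmod (m p * (z - \<sigma>) - y n) \<le> 3 * B * E * (2 * S / (real p + 1)\<^sup>2) + 2 * (S / \<kappa> / (real p + 1)\<^sup>2 * B)"
    unfolding main by (rule order_trans[OF norm_triangle_ineq4 add_mono[OF 1 2]])
  also have "\<dots> = B * S * (6 * E + 2 / \<kappa>) / (real p + 1)\<^sup>2"
    by (simp add: field_simps)
  finally show ?thesis by (simp add: y_def)
qed

section \<open>Resolvent entries and kernels\<close>

lemma cpoly_simps:
  "cpoly (p - q) z = cpoly p z - cpoly q z"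
  "cpoly (smult c p) z = of_real c * cpoly p z"
  "cpoly (pCons c p) z = of_real c + z * cpoly p z"
  "cpoly 0 z = 0"
  "cpoly 1 z = 1"
proof -
  have "map_poly complex_of_real (p - q) = map_poly of_real p - map_poly of_real q"
    by (intro poly_eqI) (simp add: coeff_map_poly)
  thus "cpoly (p - q) z = cpoly p z - cpoly q z" by (simp add: cpoly_def)
  have "map_poly complex_of_real (smult c p) = smult (of_real c) (map_poly of_real p)"
    by (intro poly_eqI) (simp add: coeff_map_poly)
  thus "cpoly (smult c p) z = of_real c * cpoly p z" by (simp add: cpoly_def)
  show "cpoly (pCons c p) z = of_real c + z * cpoly p z" by (simp add: cpoly_def map_poly_pCons)
  show "cpoly 0 z = 0" "cpoly 1 z = 1" by (simp_all add: cpoly_def)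
qed

context
  fixes \<alpha> \<beta> :: real
  assumes \<alpha>: "\<alpha> > -1" and \<beta>: "\<beta> > -1"
begin

interpretation J: jacobi_functional "\<lambda>p. jacobi_int \<alpha> \<beta> (poly p)" \<alpha> \<beta>
  using \<alpha> \<beta> by (rule jacobi_functional_jacobi_int)

lemma monic_orth_eq: "monic_orth \<alpha> \<beta> k = J.ortho k"
  unfolding monic_orth_def poly_mult[symmetric] by (rule J.ortho_eqI)

lemma b_coeff_eq: "n \<ge> 1 \<Longrightarrow> b_coeff \<alpha> \<beta> n = J.rec_b n"
proof -
  have "(\<lambda>x. (poly p x)\<^sup>2) = poly (p * p)" for p :: "real poly"
    by (simp add: fun_eq_iff power2_eq_square)
  thus "n \<ge> 1 \<Longrightarrow> ?thesis"
    by (simp add: b_coeff_def J.rec_b_def J.norm2_def monic_orth_pred_def monic_orth_eq)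
qed

text \<open>Up to normalisation, these are the entries of the resolvent of the Jacobi matrix. The function of
  the second kind of index \<open>k\<close> is \<open>green 0 k\<close>, and \<open>offdiag n\<close> is the quantity \<open>v\<^sub>n\<close> of the
  introduction.\<close>
definition green :: "nat \<Rightarrow> nat \<Rightarrow> complex \<Rightarrow> complex" where
  "green j k z = weighted_cauchy \<alpha> \<beta> (J.ortho j * J.ortho k) z"

definition offdiag :: "nat \<Rightarrow> complex \<Rightarrow> complex" where
  "offdiag n z = green n (n + 1) z / of_real (J.norm2 n)"

lemma green_sym: "green j k z = green k j z"
  by (simp add: green_def mult.commute)

lemma green_Suc:
  assumes z: "dist_interval z > 0"
  shows "green j (Suc k) z = (z - of_real (J.rec_a k)) * green j k z
     - (if k = 0 then 0 else of_real (J.rec_b k) * green j (k - 1) z)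
     - (if j = k then of_real (J.norm2 j) else 0)"
proof -
  note lin = weighted_cauchy_add[OF \<alpha> \<beta> z] weighted_cauchy_smult[OF \<alpha> \<beta> z]
  have shift: "weighted_cauchy \<alpha> \<beta> (pCons 0 p) z = z * weighted_cauchy \<alpha> \<beta> p z - of_real (jacobi_int \<alpha> \<beta> (poly p))" for p
    using weighted_cauchy_shift[OF \<alpha> \<beta> z, of p] by (simp add: algebra_simps)
  have L: "jacobi_int \<alpha> \<beta> (poly (J.ortho j * J.ortho k)) = (if j = k then J.norm2 j else 0)"
    by (rule J.L_ortho_mult_ortho)
  show ?thesis
  proof (cases k)
    case 0
    have "J.ortho j * J.ortho (Suc 0) = pCons 0 (J.ortho j * J.ortho 0) + smult (- J.rec_a 0) (J.ortho j * J.ortho 0)"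
      unfolding J.ortho_Suc_0 by simp
    thus ?thesis using L unfolding green_def 0 by (simp only: lin shift) (simp add: algebra_simps)
  next
    case (Suc i)
    have "J.ortho j * J.ortho (Suc k) = pCons 0 (J.ortho j * J.ortho k) + (smult (- J.rec_a k) (J.ortho j * J.ortho k)
        + smult (- J.rec_b k) (J.ortho j * J.ortho i))"
      unfolding Suc J.ortho_Suc_Suc by (simp add: algebra_simps)
    thus ?thesis using L unfolding green_def
      by (simp only: lin shift) (simp add: algebra_simps Suc)
  qed
qed

lemma cpoly_ortho_Suc:
  "cpoly (J.ortho (Suc k)) z = (z - of_real (J.rec_a k)) * cpoly (J.ortho k) z
     - (if k = 0 then 0 else of_real (J.rec_b k) * cpoly (J.ortho (k - 1)) z)"
proof (cases k)
  case 0
  thus ?thesis unfolding 0 J.ortho_Suc_0 by (simp add: cpoly_simps algebra_simps)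
next
  case (Suc i)
  have "J.ortho (Suc k) = pCons 0 (J.ortho k) - smult (J.rec_a k) (J.ortho k) - smult (J.rec_b k) (J.ortho i)"
    unfolding Suc J.ortho_Suc_Suc by (simp add: algebra_simps)
  hence "cpoly (J.ortho (Suc k)) z = cpoly (pCons 0 (J.ortho k) - smult (J.rec_a k) (J.ortho k) - smult (J.rec_b k) (J.ortho i)) z"
    by (simp only:)
  thus ?thesis unfolding cpoly_simps by (simp add: algebra_simps Suc)
qed

text \<open>Both sides satisfy the same recurrence in \<open>j\<close> as long as \<open>j \<le> k\<close>. One step further, at
  \<open>j = k + 1\<close>, the inhomogeneity \<open>norm2 k\<close> appears.\<close>
lemma cpoly_mult_cauchy:
  assumes z: "dist_interval z > 0" and "j \<le> k"
  shows "cpoly (J.ortho j) z * green 0 k z = green j k z"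
  using assms(2)
proof (induction j rule: less_induct)
  case (less j)
  show ?case
  proof (cases j)
    case 0
    thus ?thesis by (simp add: cpoly_simps)
  next
    case (Suc i)
    have IH: "cpoly (J.ortho i) z * green 0 k z = green i k z"
      "i \<noteq> 0 \<Longrightarrow> cpoly (J.ortho (i - 1)) z * green 0 k z = green (i - 1) k z"
      using less Suc by auto
    have "green j k z = green k (Suc i) z" by (simp add: green_sym Suc)
    also have "\<dots> = (z - of_real (J.rec_a i)) * green i k z
       - (if i = 0 then 0 else of_real (J.rec_b i) * green (i - 1) k z)"
      using less.prems Suc by (subst green_Suc[OF z]) (auto simp: green_sym[of k])
    also have "\<dots> = cpoly (J.ortho (Suc i)) z * green 0 k z"
      unfolding cpoly_ortho_Suc left_diff_distrib mult.assoc IH(1)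
      by (cases "i = 0") (simp_all add: IH(2)[simplified] mult.assoc)
    finally show ?thesis by (simp add: Suc)
  qed
qed

lemma cpoly_Suc_mult_cauchy:
  assumes z: "dist_interval z > 0"
  shows "cpoly (J.ortho (Suc k)) z * green 0 k z = green k (Suc k) z + of_real (J.norm2 k)"
proof -
  have IH: "cpoly (J.ortho k) z * green 0 k z = green k k z"
      "k \<noteq> 0 \<Longrightarrow> cpoly (J.ortho (k - 1)) z * green 0 k z = green k (k - 1) z"
    using cpoly_mult_cauchy[OF z, of k k] cpoly_mult_cauchy[OF z, of "k - 1" k]
    by (auto simp: green_sym)
  show ?thesis unfolding cpoly_ortho_Suc green_Suc[OF z] left_diff_distrib mult.assoc IH(1)
    by (cases "k = 0") (simp_all add: IH(2)[simplified] mult.assoc)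
qed

lemma weighted_cauchy_ortho: "weighted_cauchy \<alpha> \<beta> (J.ortho k) z = green 0 k z"
  by (simp add: green_def)

lemma green_bound:
  assumes z: "dist_interval z > 0"
  shows "cmod (green j k z) \<le> sqrt (J.norm2 j * J.norm2 k) / dist_interval z"
proof -
  define s where "s = sqrt (J.norm2 k) / sqrt (J.norm2 j)"
  have h: "J.norm2 j > 0" "J.norm2 k > 0" by (rule J.norm2_pos)+
  hence s: "s > 0" by (simp add: s_def)
  have "s * J.norm2 j = sqrt (J.norm2 k) * (J.norm2 j / sqrt (J.norm2 j))" by (simp add: s_def)
  hence 1: "s * J.norm2 j = sqrt (J.norm2 j * J.norm2 k)"
    using h by (simp add: real_div_sqrt real_sqrt_mult)
  have "J.norm2 k / s = J.norm2 k / sqrt (J.norm2 k) * sqrt (J.norm2 j)" by (simp add: s_def)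
  hence 2: "J.norm2 k / s = sqrt (J.norm2 j * J.norm2 k)"
    using h by (simp add: real_div_sqrt real_sqrt_mult)
  have "cmod (green j k z) \<le> (s * J.norm2 j + J.norm2 k / s) / (2 * dist_interval z)"
    unfolding green_def J.norm2_def by (rule norm_weighted_cauchy_mult_le[OF \<alpha> \<beta> z s])
  thus ?thesis unfolding 1 2 by simp
qed

lemma coefficient_bounds:
  obtains E where "\<And>k. \<bar>J.rec_a k\<bar> \<le> E / (real k + 1)\<^sup>2" "\<And>k. \<bar>sqrt (J.rec_b k) - 1/2\<bar> \<le> E / (real k + 1)\<^sup>2"
proof -
  obtain E1 where E1: "\<And>k. \<bar>J.rec_a k * (real k + 1)\<^sup>2\<bar> \<le> E1"
    using J.Bseq_rec_a unfolding Bseq_def real_norm_def by blast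
  obtain E2 where E2: "\<And>k. \<bar>(J.rec_b k - 1/4) * (real k + 1)\<^sup>2\<bar> \<le> E2"
    using J.Bseq_rec_b unfolding Bseq_def real_norm_def by blast
  define E where "E = max E1 (2 * E2)"
  have "\<bar>J.rec_a k\<bar> \<le> E / (real k + 1)\<^sup>2" for k
    using E1[of k] by (simp add: E_def pos_le_divide_eq abs_mult)
  moreover have "\<bar>sqrt (J.rec_b k) - 1/2\<bar> \<le> E / (real k + 1)\<^sup>2" for k
  proof -
    define c where "c = sqrt (J.rec_b k)"
    have c: "c \<ge> 0" "c\<^sup>2 = J.rec_b k" using J.rec_b_pos[of k] by (simp_all add: c_def)
    have "\<bar>c - 1/2\<bar> * (1/2) \<le> \<bar>c - 1/2\<bar> * (c + 1/2)" using c by (intro mult_left_mono) auto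
    also have "\<dots> = \<bar>(c - 1/2) * (c + 1/2)\<bar>" using c by (simp add: abs_mult)
    also have "(c - 1/2) * (c + 1/2) = J.rec_b k - 1/4"
      unfolding c(2)[symmetric] by (simp add: algebra_simps power2_eq_square)
    finally have "\<bar>c - 1/2\<bar> * (real k + 1)\<^sup>2 \<le> 2 * \<bar>J.rec_b k - 1/4\<bar> * (real k + 1)\<^sup>2"
      by (intro mult_right_mono) auto
    also have "\<dots> \<le> E" using E2[of k] by (simp add: E_def abs_mult)
    finally show ?thesis by (simp add: c_def pos_le_divide_eq)
  qed
  ultimately show ?thesis by (rule that)
qed

text \<open>Column \<open>n\<close> of the normalised resolvent is compared with the free one, at the entries \<open>n\<close> and
  \<open>n + 1\<close>. The limits are \<open>1 / (z - \<sigma>)\<close> on the diagonal and, since \<open>2 * (z - \<sigma>) / \<sigma> = \<rho>\<^sup>2 - 1\<close>,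
  \<open>1 / (\<rho>\<^sup>2 - 1)\<close> for \<open>offdiag\<close>, where \<open>\<rho> = rho z = 1 / \<sigma>\<close>.\<close>
lemma green_asymptotics:
  assumes d: "d > 0"
  obtains C where "C \<ge> 0"
    "\<And>n z. n \<ge> 1 \<Longrightarrow> d \<le> dist_interval z \<Longrightarrow>
       cmod (green n n z / of_real (J.norm2 n) * (z - 1 / rho z) - 1) \<le> C / (real n + 1)\<^sup>2"
    "\<And>n z. n \<ge> 1 \<Longrightarrow> d \<le> dist_interval z \<Longrightarrow>
       cmod (offdiag n z * ((rho z)\<^sup>2 - 1) - 1) \<le> C / (real n + 1)\<^sup>2"
proof -
  obtain E where E: "\<And>k. \<bar>J.rec_a k\<bar> \<le> E / (real k + 1)\<^sup>2"
      "\<And>k. \<bar>sqrt (J.rec_b k) - 1/2\<bar> \<le> E / (real k + 1)\<^sup>2"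
    using coefficient_bounds by blast
  have E0: "E \<ge> 0" using E(1)[of 0] by simp
  define \<kappa> where "\<kappa> = 1 / (1 + d)"
  have \<kappa>: "0 < \<kappa>" "\<kappa> < 1" using d by (auto simp: \<kappa>_def)
  define T where "T = suminf (\<lambda>j. \<kappa> ^ j * (real j + 1)\<^sup>2) * (6 * E + 2 / \<kappa>)"
  have T: "T \<ge> 0"
    unfolding T_def using \<kappa> E0 summable_power_times_square[of \<kappa>]
    by (intro mult_nonneg_nonneg suminf_nonneg) auto
  define C where "C = T / d + ((1 + 2 * E) * ((2 + 3 / d) * T) + 2 * E)"
  {
    fix n :: nat and z :: complex
    assume n: "n \<ge> 1" and dz: "d \<le> dist_interval z"
    define \<delta> where "\<delta> = dist_interval z"
    have \<delta>: "\<delta> > 0" "dist_interval z > 0" using d dz by (auto simp: \<delta>_def)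
    define h where "h = J.norm2"
    have h: "h k > 0" for k by (simp add: h_def J.norm2_pos)
    define \<sigma> where "\<sigma> = 1 / rho z"
    have rho: "2 * z = rho z + 1 / rho z" "cmod (rho z) \<ge> 1 + dist_interval z"
      using rho_Joukowski[OF \<delta>(2)] by auto
    have rho0: "rho z \<noteq> 0" using rho(2) \<delta> by auto
    have \<sigma>: "2 * z = \<sigma> + 1 / \<sigma>" "\<sigma> \<noteq> 0" using rho(1) rho0 by (auto simp: \<sigma>_def)
    have \<sigma>_le: "cmod \<sigma> \<le> \<kappa>"
      unfolding \<sigma>_def \<kappa>_def norm_divide norm_one using rho(2) dz d by (intro frac_le) auto
    \<comment> \<open>Normalising makes the matrix symmetric, with off-diagonal entries \<open>sqrt (rec_b k)\<close>.\<close>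
    define m where "m = (\<lambda>k. green n k z / of_real (sqrt (h n) * sqrt (h k)))"
    have m_le: "cmod (m k) \<le> 1 / \<delta>" for k
      using green_bound[OF \<delta>(2), of n k] h[of n] h[of k] \<delta>
      by (simp add: m_def \<delta>_def h_def norm_divide norm_mult real_sqrt_mult field_simps)
    have rec: "(z - of_real (J.rec_a k)) * m k - of_real (sqrt (J.rec_b (k + 1))) * m (k + 1)
        - of_real (sqrt (J.rec_b k)) * m (k - 1) = (if k = n then 1 else 0)" if k: "k \<ge> 1" for k
    proof -
      define r where "r = (\<lambda>k. complex_of_real (sqrt (h k)))"
      have r0: "r k \<noteq> 0" for k using h[of k] by (simp add: r_def)
      have rr: "complex_of_real (h k) = r k * r k" for k
        unfolding r_def of_real_mult[symmetric] using h[of k] by simp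
      have sb: "complex_of_real (sqrt (J.rec_b k)) = r k / r (k - 1)" if "k \<ge> 1" for k
        unfolding J.rec_b_def h_def[symmetric] r_def by (simp add: real_sqrt_divide)
      have b: "complex_of_real (J.rec_b k) = (r k * r k) / (r (k - 1) * r (k - 1))"
        unfolding J.rec_b_def h_def[symmetric] by (simp add: rr)
      have m: "m k = green n k z / (r n * r k)" for k by (simp add: m_def r_def)
      have "green n (k + 1) z = (z - of_real (J.rec_a k)) * green n k z
          - of_real (J.rec_b k) * green n (k - 1) z - (if n = k then of_real (h n) else 0)"
        using green_Suc[OF \<delta>(2), of n k] k by (simp add: h_def)
      hence "(z - of_real (J.rec_a k)) * green n k z - green n (k + 1) z
          - (r k * r k) / (r (k - 1) * r (k - 1)) * green n (k - 1) z = (if n = k then r n * r n else 0)"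
        unfolding b rr by (auto simp: algebra_simps)
      hence "((z - of_real (J.rec_a k)) * green n k z - green n (k + 1) z
          - (r k * r k) / (r (k - 1) * r (k - 1)) * green n (k - 1) z) / (r n * r k)
           = (if n = k then 1 else 0)"
        using r0 by auto
      moreover have "of_real (sqrt (J.rec_b (k + 1))) * m (k + 1) = green n (k + 1) z / (r n * r k)"
        unfolding sb[OF le_add2] m using r0[of "k+1"] by simp
      moreover have "of_real (sqrt (J.rec_b k)) * m (k - 1)
          = (r k * r k) / (r (k - 1) * r (k - 1)) * green n (k - 1) z / (r n * r k)"
        unfolding sb[OF k] m using r0[of k] by simp
      ultimately show ?thesis unfolding m by (auto simp: diff_divide_distrib)
    qed
    have res: "cmod (m p * (z - \<sigma>) - \<sigma> ^ ((n - p) + (p - n))) \<le> 1 / \<delta> * T / (real p + 1)\<^sup>2"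
      if "p \<ge> 1" for p
      using perturbed_resolvent[OF rec m_le E \<sigma> \<sigma>_le \<kappa> n that]
      by (simp add: T_def mult.assoc)
    have part1: "cmod (green n n z / of_real (J.norm2 n) * (z - 1 / rho z) - 1) \<le> T / d / (real n + 1)\<^sup>2"
    proof -
      have "m n = green n n z / of_real (J.norm2 n)"
        unfolding m_def h_def[symmetric] using h[of n] by (simp flip: of_real_mult)
      hence "cmod (green n n z / of_real (J.norm2 n) * (z - 1 / rho z) - 1) \<le> 1 / \<delta> * T / (real n + 1)\<^sup>2"
        using res[OF n] by (simp add: \<sigma>_def)
      also have "1 / \<delta> * T \<le> T / d"
        using T d dz by (simp add: \<delta>_def divide_left_mono)
      finally show ?thesis by (simp add: divide_right_mono)
    qed
    have part2: "cmod (offdiag n z * ((rho z)\<^sup>2 - 1) - 1)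
        \<le> ((1 + 2 * E) * ((2 + 3 / d) * T) + 2 * E) / (real n + 1)\<^sup>2"
    proof -
      define c where "c = sqrt (J.rec_b (n + 1))"
      define X where "X = m (n + 1) * (z - \<sigma>) / \<sigma>"
      have mono: "1 / (real (n + 1) + 1)\<^sup>2 \<le> 1 / (real n + 1)\<^sup>2"
        by (intro divide_left_mono power_mono) auto
      \<comment> \<open>The quantity \<open>m (n + 1) * (z - \<sigma>)\<close> is itself of order \<open>\<sigma>\<close>, so the relative error costs a factor
        \<open>rho z\<close>. The bound \<open>1 / \<delta>\<close> on the resolvent pays for it.\<close>
      have "cmod (X - 1) = cmod (m (n + 1) * (z - \<sigma>) - \<sigma>) * cmod (rho z)"
        using \<sigma>(2) rho0 by (simp add: X_def \<sigma>_def norm_mult[symmetric] algebra_simps)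
      also have "\<dots> \<le> (1 / \<delta> * T / (real (n + 1) + 1)\<^sup>2) * ((2 + 3 / d) * \<delta>)"
        using res[of "n + 1"] cmod_rho_le[OF d dz] T \<delta>
        by (intro mult_mono) (auto simp: \<delta>_def)
      also have "\<dots> = (2 + 3 / d) * T * (1 / (real (n + 1) + 1)\<^sup>2)" using \<delta> by simp
      also have "\<dots> \<le> (2 + 3 / d) * T * (1 / (real n + 1)\<^sup>2)"
        using T d by (intro mult_left_mono mono) auto
      finally have X: "cmod (X - 1) \<le> (2 + 3 / d) * T / (real n + 1)\<^sup>2" by simp
      have "\<bar>c - 1/2\<bar> \<le> E * (1 / (real (n + 1) + 1)\<^sup>2)" unfolding c_def using E(2)[of "n + 1"] by simp
      also have "\<dots> \<le> E * (1 / (real n + 1)\<^sup>2)" using E0 by (intro mult_left_mono mono)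
      finally have c: "\<bar>c - 1/2\<bar> \<le> E / (real n + 1)\<^sup>2" by simp
      also have "\<dots> \<le> E / 1" using E0 by (intro divide_left_mono) auto
      finally have c': "\<bar>2 * c\<bar> \<le> 1 + 2 * E" by simp
      have "c = sqrt (h (n + 1)) / sqrt (h n)" by (simp add: c_def J.rec_b_def h_def real_sqrt_divide)
      moreover have "complex_of_real (h n) = of_real (sqrt (h n)) * of_real (sqrt (h n))"
        unfolding of_real_mult[symmetric] using h[of n] by simp
      ultimately have "offdiag n z = of_real c * m (n + 1)"
        using h[of n] h[of "n + 1"] by (simp add: offdiag_def m_def h_def[symmetric])
      moreover have "(rho z)\<^sup>2 - 1 = 2 * ((z - \<sigma>) / \<sigma>)"
      proof -
        have "2 * ((z - \<sigma>) / \<sigma>) = (2 * z - 2 * \<sigma>) * rho z" by (simp add: \<sigma>_def)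
        also have "\<dots> = (rho z)\<^sup>2 - 1"
          unfolding rho(1) using rho0 by (simp add: \<sigma>_def algebra_simps power2_eq_square)
        finally show ?thesis ..
      qed
      ultimately have "offdiag n z * ((rho z)\<^sup>2 - 1) - 1 = of_real (2 * c) * (X - 1) + of_real (2 * (c - 1/2))"
        by (simp add: X_def algebra_simps)
      hence "cmod (offdiag n z * ((rho z)\<^sup>2 - 1) - 1) \<le> \<bar>2 * c\<bar> * cmod (X - 1) + \<bar>2 * (c - 1/2)\<bar>"
        by (metis norm_mult norm_of_real norm_triangle_ineq)
      also have "\<dots> \<le> (1 + 2 * E) * ((2 + 3 / d) * T / (real n + 1)\<^sup>2) + 2 * (E / (real n + 1)\<^sup>2)"
        using c c' X E0 by (intro add_mono mult_mono) auto
      finally show ?thesis by (simp add: add_divide_distrib)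
    qed
    have "T / d \<le> C" "(1 + 2 * E) * ((2 + 3 / d) * T) + 2 * E \<le> C"
      unfolding C_def using T E0 d by (auto intro!: add_nonneg_nonneg mult_nonneg_nonneg)
    hence "T / d / (real n + 1)\<^sup>2 \<le> C / (real n + 1)\<^sup>2"
      "((1 + 2 * E) * ((2 + 3 / d) * T) + 2 * E) / (real n + 1)\<^sup>2 \<le> C / (real n + 1)\<^sup>2"
      by (intro divide_right_mono; simp)+
    note order_trans[OF part1 this(1)] order_trans[OF part2 this(2)]
  }
  moreover have "C \<ge> 0" unfolding C_def using T E0 d by simp
  ultimately show ?thesis by (intro that)
qed

text \<open>This excludes zeros of \<open>\<phi>\<^sub>n\<close> and \<open>q\<^sub>n\<close> away from the interval, as \<open>green n n\<close> is their product.\<close>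
lemma eventually_green_diag_nonzero:
  assumes d: "d > 0"
  shows "\<forall>\<^sub>F n in sequentially. \<forall>z. d \<le> dist_interval z \<longrightarrow> green n n z \<noteq> 0"
proof -
  obtain C where C: "\<And>n z. n \<ge> 1 \<Longrightarrow> d \<le> dist_interval z \<Longrightarrow>
       cmod (green n n z / of_real (J.norm2 n) * (z - 1 / rho z) - 1) \<le> C / (real n + 1)\<^sup>2"
    using green_asymptotics[OF d] by metis
  have "(\<lambda>n. C / (real n + 1)\<^sup>2) \<longlonglongrightarrow> 0" by real_asymp
  hence "\<forall>\<^sub>F n in sequentially. C / (real n + 1)\<^sup>2 < 1" by (rule order_tendstoD) simp
  thus ?thesis using eventually_ge_at_top[of 1]
  proof eventually_elim
    case (elim n)
    show ?case
    proof (intro allI impI notI)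
      fix z assume "d \<le> dist_interval z" "green n n z = 0"
      thus False using C[OF elim(2), of z] elim(1) by simp
    qed
  qed
qed

text \<open>The products of \<open>\<phi>\<close> and \<open>q\<close> with neighbouring indices are, up to \<open>norm2 n\<close>, equal to
  \<open>offdiag n\<close> or \<open>offdiag n + 1\<close>. Multiplying the numerator of \<open>K_H\<close> by \<open>\<phi>\<^sub>n\<close> and its denominator by
  \<open>q\<^sub>n\<close> leaves only such products.\<close>
lemma kernel_ratios:
  fixes \<theta> :: real
  assumes z: "dist_interval z > 0" and n: "n \<ge> 1" and nz: "green n n z \<noteq> 0"
  defines "D \<equiv> offdiag n z - of_real \<theta> * offdiag (n - 1) z"
  assumes D: "1 + D \<noteq> 0" and \<theta>: "1 + \<theta> \<noteq> 0"
  shows "K_G \<alpha> \<beta> n z \<noteq> 0"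
    "K_H \<theta> \<alpha> \<beta> n z = K_G \<alpha> \<beta> n z * ((D - of_real \<theta>) / (1 + D))"
    "K_A \<theta> \<alpha> \<beta> n z = K_G \<alpha> \<beta> n z * (D / (1 + D))"
proof -
  define P where "P = (\<lambda>k. cpoly (J.ortho k) z)"
  define q where "q = (\<lambda>k. green 0 k z)"
  define h where "h = J.norm2 n"
  define b where "b = J.rec_b n"
  have h: "h > 0" by (simp add: h_def J.norm2_pos)
  have b: "complex_of_real h = of_real b * of_real (J.norm2 (n - 1))"
    using J.norm2_pos[of "n - 1"] by (simp add: b_def h_def J.rec_b_def)
  have PQ: "P n * q n = green n n z" unfolding P_def q_def by (rule cpoly_mult_cauchy[OF z]) simp
  hence nz': "P n \<noteq> 0" "q n \<noteq> 0" using nz by auto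
  have od: "green k (Suc k) z = of_real (J.norm2 k) * offdiag k z" for k
    using J.norm2_pos[of k] by (simp add: offdiag_def)
  have 1: "P n * q (n + 1) = of_real h * offdiag n z"
    using cpoly_mult_cauchy[OF z, of n "n + 1"] od[of n] by (simp add: P_def q_def h_def)
  have 2: "P (n + 1) * q n = of_real h * (offdiag n z + 1)"
    using cpoly_Suc_mult_cauchy[OF z, of n] od[of n] by (simp add: P_def q_def h_def algebra_simps)
  have 3: "of_real b * (P (n - 1) * q n) = of_real h * offdiag (n - 1) z"
    using cpoly_mult_cauchy[OF z, of "n - 1" n] od[of "n - 1"] n b by (simp add: P_def q_def)
  have 4: "of_real b * (P n * q (n - 1)) = of_real h * (offdiag (n - 1) z + 1)"
    using cpoly_Suc_mult_cauchy[OF z, of "n - 1"] od[of "n - 1"] n b by (simp add: P_def q_def algebra_simps)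
  have KG: "K_G \<alpha> \<beta> n z = q n / P n"
    by (simp add: K_G_def monic_orth_eq weighted_cauchy_ortho P_def q_def)
  show "K_G \<alpha> \<beta> n z \<noteq> 0" using nz' by (simp add: KG)
  have np: "node_poly \<theta> \<alpha> \<beta> n = J.ortho (n + 1) - smult (\<theta> * b) (J.ortho (n - 1))"
    using n by (simp add: node_poly_def monic_orth_eq monic_orth_pred_def b_coeff_eq b_def)
  have den: "q n * cpoly (node_poly \<theta> \<alpha> \<beta> n) z = of_real h * (1 + D)"
  proof -
    have "q n * cpoly (node_poly \<theta> \<alpha> \<beta> n) z = P (n + 1) * q n - of_real \<theta> * (of_real b * (P (n - 1) * q n))"
      unfolding np P_def by (simp add: cpoly_simps algebra_simps)
    thus ?thesis unfolding 2 3 D_def by (simp add: algebra_simps)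
  qed
  have num: "P n * weighted_cauchy \<alpha> \<beta> (node_poly \<theta> \<alpha> \<beta> n) z = of_real h * (D - of_real \<theta>)"
  proof -
    have "node_poly \<theta> \<alpha> \<beta> n = J.ortho (n + 1) + smult (- (\<theta> * b)) (J.ortho (n - 1))" by (simp add: np)
    hence wc: "weighted_cauchy \<alpha> \<beta> (node_poly \<theta> \<alpha> \<beta> n) z = q (n + 1) - of_real \<theta> * of_real b * q (n - 1)"
      by (simp only: weighted_cauchy_add[OF \<alpha> \<beta> z] weighted_cauchy_smult[OF \<alpha> \<beta> z] weighted_cauchy_ortho)
        (simp add: q_def)
    have "P n * weighted_cauchy \<alpha> \<beta> (node_poly \<theta> \<alpha> \<beta> n) z =
        P n * q (n + 1) - of_real \<theta> * (of_real b * (P n * q (n - 1)))"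
      unfolding wc by (simp add: algebra_simps)
    thus ?thesis unfolding 1 4 D_def by (simp add: algebra_simps)
  qed
  have h': "complex_of_real h \<noteq> 0" using h by simp
  show KH: "K_H \<theta> \<alpha> \<beta> n z = K_G \<alpha> \<beta> n z * ((D - of_real \<theta>) / (1 + D))"
  proof -
    have "weighted_cauchy \<alpha> \<beta> (node_poly \<theta> \<alpha> \<beta> n) z = of_real h * (D - of_real \<theta>) / P n"
      using num nz' by (simp add: field_simps)
    moreover have "cpoly (node_poly \<theta> \<alpha> \<beta> n) z = of_real h * (1 + D) / q n"
      using den nz' by (simp add: field_simps)
    ultimately show ?thesis unfolding K_H_def KG using h' by simp
  qed
  have \<theta>': "1 + complex_of_real \<theta> \<noteq> 0" using \<theta> by (metis of_real_1 of_real_add of_real_eq_0_iff)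
  have "K_A \<theta> \<alpha> \<beta> n z = K_G \<alpha> \<beta> n z * ((D - of_real \<theta>) / (1 + D) + of_real \<theta>) / (1 + of_real \<theta>)"
  proof -
    have "1 / t * (K * X) + s / t * K = K * (X + s) / t" for K X s t :: complex
      by (simp add: add_divide_distrib algebra_simps)
    thus ?thesis unfolding K_A_def KH of_real_divide of_real_add of_real_1 .
  qed
  also have "(D - of_real \<theta>) / (1 + D) + of_real \<theta> = D / (1 + D) * (1 + of_real \<theta>)"
    using D by (simp add: field_simps)
  finally show "K_A \<theta> \<alpha> \<beta> n z = K_G \<alpha> \<beta> n z * (D / (1 + D))" using \<theta>' by simp
qed

end

section \<open>Asymptotics of the kernels\<close>

lemma h_aux_limit: "(\<lambda>n. real n * (h_aux n x y - 1)) \<longlonglongrightarrow> 2 * x + 1"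
  unfolding h_aux_def by real_asymp

text \<open>Multiplication by \<open>n\<close> commutes with the minimum, so the limit is the smaller one of the limits
  \<open>2 * \<alpha> + 1\<close> and \<open>2 * \<beta> + 1\<close> of the two candidates.\<close>
lemma theta_max_limit:
  "(\<lambda>n. real n * (theta_max n \<alpha> \<beta> - 1)) \<longlonglongrightarrow> 2 * min \<alpha> \<beta> + 1"
proof -
  have "real n * (theta_max n \<alpha> \<beta> - 1) = min (real n * (h_aux n \<alpha> \<beta> - 1)) (real n * (h_aux n \<beta> \<alpha> - 1))" for n
    by (simp add: theta_max_def min_diff_distrib_left min_mult_distrib_left)
  moreover have "min (2 * \<alpha> + 1) (2 * \<beta> + 1) = 2 * min \<alpha> \<beta> + 1" by (simp add: min_def)
  ultimately show ?thesis using tendsto_min[OF h_aux_limit[of \<alpha> \<beta>] h_aux_limit[of \<beta> \<alpha>]] by simp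
qed

lemma uniform_limit_bound:
  fixes f :: "nat \<Rightarrow> 'a \<Rightarrow> 'b :: real_normed_vector"
  assumes "\<And>n z. n \<ge> N \<Longrightarrow> z \<in> S \<Longrightarrow> norm (f n z) \<le> b n" "b \<longlonglongrightarrow> 0"
  shows "uniform_limit S f (\<lambda>_. 0) sequentially"
proof (rule uniform_limitI)
  fix e :: real assume "e > 0"
  with assms(2) have "\<forall>\<^sub>F n in sequentially. b n < e" by (rule order_tendstoD)
  thus "\<forall>\<^sub>F n in sequentially. \<forall>z\<in>S. dist (f n z) 0 < e"
    using eventually_ge_at_top[of N]
    by eventually_elim (auto intro: le_less_trans[OF assms(1)])
qed

lemma uniform_limit_one_divide:
  fixes f g :: "nat \<Rightarrow> 'a \<Rightarrow> complex"
  assumes "uniform_limit S f (\<lambda>_. 1) F" "uniform_limit S g (\<lambda>_. 1) F"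
  shows "uniform_limit S (\<lambda>n z. f n z / g n z) (\<lambda>_. 1) F"
proof -
  have bdd: "bounded ((\<lambda>_::'a. 1::complex) ` S)"
    by (rule bounded_subset[of "{1}"]) auto
  have "uniform_limit S (\<lambda>n z. inverse (g n z)) (inverse \<circ> (\<lambda>_. 1)) F"
    by (rule uniform_lim_inverse[OF assms(2), of 1]) auto
  hence "uniform_limit S (\<lambda>n z. inverse (g n z)) (\<lambda>_. 1) F" by (simp add: o_def)
  from uniform_lim_mult[OF assms(1) this bdd bdd] show ?thesis by (simp add: divide_inverse)
qed

theorem proposition4p1:
  fixes \<alpha> \<beta> :: real and \<theta> g :: "nat \<Rightarrow> real"
  assumes "\<alpha> > -1" and "\<beta> > -1"
    and not_internal: "\<forall>\<^sub>F n in sequentially. \<not> internal (anti_gauss_rule 1 \<alpha> \<beta> n)"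
    and theta: "\<And>n. \<theta> n = theta_max n \<alpha> \<beta>"
    and g: "\<And>n. g n = \<theta> n - 1"
  shows "asymp_off_interval
           (\<lambda>n z. K_H (\<theta> n) \<alpha> \<beta> n z)
           (\<lambda>n z. - K_G \<alpha> \<beta> n z * (1 - of_real (g n) * ((1 + (rho z)\<^sup>2) / (1 - (rho z)\<^sup>2)))) \<and>
         (min \<alpha> \<beta> \<noteq> -1/2 \<longrightarrow>
           asymp_off_interval
             (\<lambda>n z. K_A (\<theta> n) \<alpha> \<beta> n z)
             (\<lambda>n z. K_G \<alpha> \<beta> n z * (of_real (g n) / (1 - (rho z)\<^sup>2))) \<and>
           (\<alpha> \<le> \<beta> \<longrightarrow> g \<sim>[sequentially] (\<lambda>n. (2 * \<alpha> + 1) / real n)) \<and>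
           (\<alpha> \<ge> \<beta> \<longrightarrow> g \<sim>[sequentially] (\<lambda>n. (2 * \<beta> + 1) / real n)))"
proof -
  define \<gamma> where "\<gamma> = 2 * min \<alpha> \<beta> + 1"
  have ng: "(\<lambda>n. real n * g n) \<longlonglongrightarrow> \<gamma>"
    unfolding g theta \<gamma>_def by (rule theta_max_limit)
  have g0: "g \<longlonglongrightarrow> 0"
  proof -
    have "(\<lambda>n. real n * g n * (1 / real n)) \<longlonglongrightarrow> \<gamma> * 0"
      by (intro tendsto_mult ng lim_1_over_n)
    moreover have "\<forall>\<^sub>F n in sequentially. real n * g n * (1 / real n) = g n"
      using eventually_gt_at_top[of 0] by eventually_elim simp
    ultimately show ?thesis by (simp add: tendsto_cong)
  qed
  have \<theta>g: "\<theta> n = 1 + g n" for n by (simp add: g)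
  have asymp: "g \<sim>[sequentially] (\<lambda>n. c / real n)" if "\<gamma> = c" "c \<noteq> 0" for c
  proof (rule asymp_equivI')
    have "(\<lambda>n. real n * g n / c) \<longlonglongrightarrow> \<gamma> / c" using that by (intro tendsto_intros ng)
    thus "(\<lambda>n. g n / (c / real n)) \<longlonglongrightarrow> 1" using that by (simp add: mult.commute)
  qed
  have main: "uniform_limit (- U) (\<lambda>n z. K_H (\<theta> n) \<alpha> \<beta> n z /
         (- K_G \<alpha> \<beta> n z * (1 - of_real (g n) * ((1 + (rho z)\<^sup>2) / (1 - (rho z)\<^sup>2))))) (\<lambda>_. 1) sequentially"
    "\<gamma> \<noteq> 0 \<Longrightarrow> uniform_limit (- U) (\<lambda>n z. K_A (\<theta> n) \<alpha> \<beta> n z /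
         (K_G \<alpha> \<beta> n z * (of_real (g n) / (1 - (rho z)\<^sup>2)))) (\<lambda>_. 1) sequentially"
    if U: "open U" "complex_of_real ` {-1..1} \<subseteq> U" for U
  proof -
    obtain d where d: "d > 0" "\<And>z. z \<in> - U \<Longrightarrow> d \<le> dist_interval z"
      using dist_interval_bounded_below[OF U] by blast
    obtain C where C0: "C \<ge> 0" and C: "\<And>n z. n \<ge> 1 \<Longrightarrow> d \<le> dist_interval z \<Longrightarrow>
         cmod (offdiag \<alpha> \<beta> n z * ((rho z)\<^sup>2 - 1) - 1) \<le> C / (real n + 1)\<^sup>2"
      using green_asymptotics[OF assms(1,2) d(1)] by metis
    \<comment> \<open>\<open>\<omega>\<close> is the limit of \<open>offdiag n\<close> and \<open>\<eta> n\<close> its relative error, so that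
      \<open>offdiag n z = \<omega> z * (1 + \<eta> n z)\<close>.\<close>
    define \<eta> where "\<eta> = (\<lambda>n z. offdiag \<alpha> \<beta> n z * ((rho z)\<^sup>2 - 1) - 1)"
    define c where "c = (\<lambda>z. (1 + (rho z)\<^sup>2) / (1 - (rho z)\<^sup>2))"
    define \<omega> where "\<omega> = (\<lambda>z. 1 / ((rho z)\<^sup>2 - 1))"
    define D where "D = (\<lambda>n z. offdiag \<alpha> \<beta> n z - of_real (\<theta> n) * offdiag \<alpha> \<beta> (n - 1) z)"
    have \<omega>: "(rho z)\<^sup>2 - 1 \<noteq> 0" "cmod (\<omega> z) \<le> 1 / (2 * d)" if "z \<in> - U" for z
    proof -
      have "1 + d \<le> cmod (rho z)" using rho_Joukowski(2)[of z] d(2)[OF that] d(1) by linarith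
      hence "(1 + d)\<^sup>2 \<le> (cmod (rho z))\<^sup>2" using d(1) by (intro power_mono) auto
      also have "\<dots> = cmod ((rho z)\<^sup>2)" by (simp add: norm_power)
      also have "\<dots> \<le> cmod ((rho z)\<^sup>2 - 1) + 1" using norm_triangle_sub[of "(rho z)\<^sup>2" 1] by simp
      finally have "(1 + d)\<^sup>2 \<le> cmod ((rho z)\<^sup>2 - 1) + 1" .
      moreover have "(1 + d)\<^sup>2 = 1 + 2 * d + d\<^sup>2" by (simp add: power2_eq_square algebra_simps)
      ultimately have *: "2 * d \<le> cmod ((rho z)\<^sup>2 - 1)" using zero_le_power2[of d] by linarith
      thus "(rho z)\<^sup>2 - 1 \<noteq> 0" using d(1) by auto
      show "cmod (\<omega> z) \<le> 1 / (2 * d)"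
        unfolding \<omega>_def norm_divide norm_one using * d(1) by (intro frac_le) auto
    qed
    have c: "c z = - 1 - 2 * \<omega> z" if "z \<in> - U" for z
      using \<omega>(1)[OF that] unfolding c_def \<omega>_def by (simp add: divide_simps) algebra
    have D_eq: "D n z = \<omega> z * (\<eta> n z - \<eta> (n - 1) z - of_real (g n) * (1 + \<eta> (n - 1) z))" if "z \<in> - U" for n z
      using \<omega>(1)[OF that] by (simp add: D_def \<omega>_def \<eta>_def \<theta>g field_simps)
    \<comment> \<open>The bound at index \<open>n - 1\<close> requires \<open>n - 1 \<ge> 1\<close>.\<close>
    have eta_le: "cmod (\<eta> n z) \<le> C / (real n)\<^sup>2" "cmod (\<eta> (n - 1) z) \<le> C / (real n)\<^sup>2"
      if "n \<ge> 2" "z \<in> - U" for n z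
    proof -
      have "C / (real n + 1)\<^sup>2 \<le> C / (real n)\<^sup>2" using C0 that by (intro divide_left_mono power_mono) auto
      thus "cmod (\<eta> n z) \<le> C / (real n)\<^sup>2"
        using C[of n z] d(2)[of z] that by (simp add: \<eta>_def)
      show "cmod (\<eta> (n - 1) z) \<le> C / (real n)\<^sup>2"
        using C[of "n - 1" z] d(2)[of z] that by (simp add: \<eta>_def of_nat_diff)
    qed
    have Cn: "(\<lambda>n. C / (real n)\<^sup>2) \<longlonglongrightarrow> 0" by real_asymp
    have u\<eta>: "uniform_limit (- U) (\<lambda>n. \<eta> (n - 1)) (\<lambda>_. 0) sequentially"
      by (rule uniform_limit_bound[OF _ Cn, of 2]; rule eta_le; assumption)
    have ug: "uniform_limit (- U) (\<lambda>n z. complex_of_real (g n)) (\<lambda>_. 0) sequentially"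
      using g0 by (intro uniform_limit_bound[of 0 _ _ "\<lambda>n. \<bar>g n\<bar>"] tendsto_rabs_zero) auto
    have uD: "uniform_limit (- U) D (\<lambda>_. 0) sequentially"
    proof (rule uniform_limit_bound)
      fix n :: nat and z assume n: "n \<ge> 2" and z: "z \<in> - U"
      define e where "e = C / (real n)\<^sup>2"
      have eta: "cmod (\<eta> n z) \<le> e" "cmod (\<eta> (n - 1) z) \<le> e"
        using eta_le[OF n z] by (auto simp: e_def)
      have "cmod (1 + \<eta> (n - 1) z) \<le> 1 + e"
        using norm_triangle_ineq[of 1 "\<eta> (n - 1) z"] eta by simp
      hence "cmod (of_real (g n) * (1 + \<eta> (n - 1) z)) \<le> \<bar>g n\<bar> * (1 + e)"
        unfolding norm_mult norm_of_real by (intro mult_left_mono) auto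
      hence "cmod (\<eta> n z - \<eta> (n - 1) z - of_real (g n) * (1 + \<eta> (n - 1) z)) \<le> e + e + \<bar>g n\<bar> * (1 + e)"
        by (intro order_trans[OF norm_triangle_ineq4] add_mono eta)
      hence "cmod (D n z) \<le> 1 / (2 * d) * (e + e + \<bar>g n\<bar> * (1 + e))"
        unfolding D_eq[OF z] norm_mult using \<omega>(2)[OF z] d(1) by (intro mult_mono) auto
      thus "cmod (D n z) \<le> 1 / (2 * d) * (C / (real n)\<^sup>2 + C / (real n)\<^sup>2 + \<bar>g n\<bar> * (1 + C / (real n)\<^sup>2))"
        by (simp add: e_def)
    next
      have "(\<lambda>n. 1 / (2 * d) * (C / (real n)\<^sup>2 + C / (real n)\<^sup>2 + \<bar>g n\<bar> * (1 + C / (real n)\<^sup>2)))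
          \<longlonglongrightarrow> 1 / (2 * d) * (0 + 0 + \<bar>0\<bar> * (1 + 0))"
        by (intro tendsto_intros Cn g0)
      thus "(\<lambda>n. 1 / (2 * d) * (C / (real n)\<^sup>2 + C / (real n)\<^sup>2 + \<bar>g n\<bar> * (1 + C / (real n)\<^sup>2))) \<longlonglongrightarrow> 0"
        by simp
    qed
    have "uniform_limit (- U) (\<lambda>n z. 1 + D n z) (\<lambda>_. 1 + 0) sequentially"
      by (intro uniform_limit_add uniform_limit_const uD)
    hence u1: "uniform_limit (- U) (\<lambda>n z. 1 + D n z) (\<lambda>_. 1) sequentially" by simp
    have ev: "\<forall>\<^sub>F n in sequentially. \<forall>z\<in>- U. K_G \<alpha> \<beta> n z \<noteq> 0 \<and>
        K_H (\<theta> n) \<alpha> \<beta> n z = K_G \<alpha> \<beta> n z * ((D n z - of_real (\<theta> n)) / (1 + D n z)) \<and>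
        K_A (\<theta> n) \<alpha> \<beta> n z = K_G \<alpha> \<beta> n z * (D n z / (1 + D n z))"
    proof -
      have "\<forall>\<^sub>F n in sequentially. \<forall>z\<in>- U. dist (D n z) 0 < 1"
        using uD by (rule uniform_limitD) simp
      moreover have "\<forall>\<^sub>F n in sequentially. g n > -2"
        using g0 by (rule order_tendstoD) simp
      ultimately show ?thesis
        using eventually_green_diag_nonzero[OF assms(1,2) d(1)] eventually_ge_at_top[of 1]
      proof eventually_elim
        case (elim n)
        show ?case
        proof
          fix z assume z: "z \<in> - U"
          have dz: "dist_interval z > 0" using d z by force
          have "1 + D n z \<noteq> 0"
          proof
            assume "1 + D n z = 0"
            hence "D n z = - 1" by (simp add: eq_neg_iff_add_eq_0 add.commute)
            hence "cmod (D n z) = 1" by simp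
            thus False using bspec[OF elim(1) z] by simp
          qed
          moreover have "1 + \<theta> n \<noteq> 0" using elim(2) by (simp add: \<theta>g)
          moreover have "green \<alpha> \<beta> n n z \<noteq> 0" using elim(3) d(2)[OF z] by blast
          ultimately show "K_G \<alpha> \<beta> n z \<noteq> 0 \<and>
            K_H (\<theta> n) \<alpha> \<beta> n z = K_G \<alpha> \<beta> n z * ((D n z - of_real (\<theta> n)) / (1 + D n z)) \<and>
            K_A (\<theta> n) \<alpha> \<beta> n z = K_G \<alpha> \<beta> n z * (D n z / (1 + D n z))"
            using kernel_ratios[OF assms(1,2) dz elim(4), of "\<theta> n"] unfolding D_def by blast
        qed
      qed
    qed
    show "uniform_limit (- U) (\<lambda>n z. K_H (\<theta> n) \<alpha> \<beta> n z /
         (- K_G \<alpha> \<beta> n z * (1 - of_real (g n) * ((1 + (rho z)\<^sup>2) / (1 - (rho z)\<^sup>2))))) (\<lambda>_. 1) sequentially"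
    proof -
      have "uniform_limit (- U) (\<lambda>n z. of_real (g n) * c z) (\<lambda>_. 0) sequentially"
      proof (rule uniform_limit_bound)
        fix n :: nat and z assume "z \<in> - U"
        hence "cmod (c z) \<le> 1 + 1 / d"
          using norm_triangle_ineq4[of "- 1" "2 * \<omega> z"] \<omega>(2)[of z]
          by (simp add: c norm_mult field_simps)
        thus "cmod (of_real (g n) * c z) \<le> \<bar>g n\<bar> * (1 + 1 / d)"
          unfolding norm_mult norm_of_real by (intro mult_left_mono) auto
      next
        have "(\<lambda>n. \<bar>g n\<bar> * (1 + 1 / d)) \<longlonglongrightarrow> \<bar>0\<bar> * (1 + 1 / d)"
          by (intro tendsto_intros g0)
        thus "(\<lambda>n. \<bar>g n\<bar> * (1 + 1 / d)) \<longlonglongrightarrow> 0" by simp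
      qed
      hence "uniform_limit (- U) (\<lambda>n z. 1 - of_real (g n) * c z) (\<lambda>_. 1 - 0) sequentially"
        by (intro uniform_limit_minus uniform_limit_const)
      hence den: "uniform_limit (- U) (\<lambda>n z. 1 - of_real (g n) * c z) (\<lambda>_. 1) sequentially" by simp
      have "uniform_limit (- U) (\<lambda>n z. 1 + of_real (g n) - D n z) (\<lambda>_. 1 + 0 - 0) sequentially"
        by (intro uniform_limit_minus uniform_limit_add uniform_limit_const ug uD)
      hence num: "uniform_limit (- U) (\<lambda>n z. 1 + of_real (g n) - D n z) (\<lambda>_. 1) sequentially" by simp
      have "uniform_limit (- U) (\<lambda>n z. (1 + of_real (g n) - D n z) / (1 + D n z) / (1 - of_real (g n) * c z))
          (\<lambda>_. 1) sequentially"
        by (intro uniform_limit_one_divide num u1 den)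
      moreover have "\<forall>\<^sub>F n in sequentially. \<forall>z\<in>- U.
          (1 + of_real (g n) - D n z) / (1 + D n z) / (1 - of_real (g n) * c z) =
          K_H (\<theta> n) \<alpha> \<beta> n z / (- K_G \<alpha> \<beta> n z * (1 - of_real (g n) * ((1 + (rho z)\<^sup>2) / (1 - (rho z)\<^sup>2))))"
        using ev
      proof eventually_elim
        case (elim n)
        have eq: "K * ((D - t) / e) / (- K * y) = (t - D) / e / y" if "K \<noteq> 0" for K D t e y :: complex
        proof -
          have "K * ((D - t) / e) / (- K * y) = - (((D - t) / e) / y)" using that by simp
          also have "\<dots> = (t - D) / e / y" by (simp add: minus_divide_left)
          finally show ?thesis .
        qed
        show ?case
        proof
          fix z assume "z \<in> - U"
          with elim have K: "K_G \<alpha> \<beta> n z \<noteq> 0"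
            "K_H (\<theta> n) \<alpha> \<beta> n z = K_G \<alpha> \<beta> n z * ((D n z - of_real (\<theta> n)) / (1 + D n z))" by auto
          show "(1 + of_real (g n) - D n z) / (1 + D n z) / (1 - of_real (g n) * c z) =
            K_H (\<theta> n) \<alpha> \<beta> n z / (- K_G \<alpha> \<beta> n z * (1 - of_real (g n) * ((1 + (rho z)\<^sup>2) / (1 - (rho z)\<^sup>2))))"
            unfolding K(2) eq[OF K(1)] c_def by (simp add: \<theta>g)
        qed
      qed
      ultimately show ?thesis by (subst (asm) uniform_limit_cong) auto
    qed
    show "uniform_limit (- U) (\<lambda>n z. K_A (\<theta> n) \<alpha> \<beta> n z /
         (K_G \<alpha> \<beta> n z * (of_real (g n) / (1 - (rho z)\<^sup>2)))) (\<lambda>_. 1) sequentially" if "\<gamma> \<noteq> 0"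
    proof -
      have ng': "(\<lambda>n. C / real n / \<bar>real n * g n\<bar>) \<longlonglongrightarrow> 0 / \<bar>\<gamma>\<bar>"
        using that by (intro tendsto_intros ng lim_const_over_n) auto
      \<comment> \<open>Dividing by \<open>g n\<close>, which decays like \<open>\<gamma> / n\<close>, leaves a bound of order \<open>1 / n\<close>.\<close>
      have quot: "uniform_limit (- U) (\<lambda>n z. (\<eta> n z - \<eta> (n - 1) z) / of_real (g n)) (\<lambda>_. 0) sequentially"
      proof (rule uniform_limit_bound)
        fix n :: nat and z assume n: "n \<ge> 2" and z: "z \<in> - U"
        have "cmod (\<eta> n z - \<eta> (n - 1) z) \<le> 2 * (C / (real n)\<^sup>2)"
          using norm_triangle_ineq4[of "\<eta> n z" "\<eta> (n - 1) z"] eta_le[OF n z] by simp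
        hence "cmod ((\<eta> n z - \<eta> (n - 1) z) / of_real (g n)) \<le> 2 * (C / (real n)\<^sup>2) / \<bar>g n\<bar>"
          unfolding norm_divide norm_of_real by (intro divide_right_mono) auto
        also have "\<dots> = 2 * (C / real n / \<bar>real n * g n\<bar>)"
          by (simp add: abs_mult power2_eq_square)
        finally show "cmod ((\<eta> n z - \<eta> (n - 1) z) / of_real (g n)) \<le> 2 * (C / real n / \<bar>real n * g n\<bar>)" .
      next
        show "(\<lambda>n. 2 * (C / real n / \<bar>real n * g n\<bar>)) \<longlonglongrightarrow> 0"
          using tendsto_mult_left[OF ng', of 2] by simp
      qed
      have "uniform_limit (- U) (\<lambda>n z. 1 + \<eta> (n - 1) z - (\<eta> n z - \<eta> (n - 1) z) / of_real (g n))
          (\<lambda>_. 1 + 0 - 0) sequentially"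
        by (intro uniform_limit_minus uniform_limit_add uniform_limit_const u\<eta> quot)
      hence num: "uniform_limit (- U) (\<lambda>n z. 1 + \<eta> (n - 1) z - (\<eta> n z - \<eta> (n - 1) z) / of_real (g n))
          (\<lambda>_. 1) sequentially" by simp
      have "uniform_limit (- U) (\<lambda>n z. (1 + \<eta> (n - 1) z - (\<eta> n z - \<eta> (n - 1) z) / of_real (g n)) / (1 + D n z))
          (\<lambda>_. 1) sequentially"
        by (intro uniform_limit_one_divide num u1)
      moreover have "\<forall>\<^sub>F n in sequentially. g n \<noteq> 0"
      proof -
        have "\<forall>\<^sub>F n in sequentially. real n * g n \<noteq> 0" using ng that by (rule tendsto_imp_eventually_ne)
        thus ?thesis by eventually_elim auto
      qed
      with ev have "\<forall>\<^sub>F n in sequentially. \<forall>z\<in>- U.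
          (1 + \<eta> (n - 1) z - (\<eta> n z - \<eta> (n - 1) z) / of_real (g n)) / (1 + D n z) =
          K_A (\<theta> n) \<alpha> \<beta> n z / (K_G \<alpha> \<beta> n z * (of_real (g n) / (1 - (rho z)\<^sup>2)))"
      proof eventually_elim
        case (elim n)
        show ?case
        proof
          fix z assume z: "z \<in> - U"
          with elim(1) have K: "K_G \<alpha> \<beta> n z \<noteq> 0"
            "K_A (\<theta> n) \<alpha> \<beta> n z = K_G \<alpha> \<beta> n z * (D n z / (1 + D n z))" by auto
          have eq: "K * (D / e) / (K * (s / r)) = D * r / s / e" if "K \<noteq> 0" for K D e s r :: complex
            using that by simp
          have D: "D n z * (1 - (rho z)\<^sup>2) = of_real (g n) * (1 + \<eta> (n - 1) z) - (\<eta> n z - \<eta> (n - 1) z)"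
          proof -
            have \<omega>1: "\<omega> z * (1 - (rho z)\<^sup>2) = - 1"
              using \<omega>(1)[OF z] by (simp add: \<omega>_def divide_eq_eq)
            have "D n z * (1 - (rho z)\<^sup>2) = (\<omega> z * (1 - (rho z)\<^sup>2)) *
                (\<eta> n z - \<eta> (n - 1) z - of_real (g n) * (1 + \<eta> (n - 1) z))"
              unfolding D_eq[OF z] by (simp only: mult_ac)
            thus ?thesis unfolding \<omega>1 by simp
          qed
          show "(1 + \<eta> (n - 1) z - (\<eta> n z - \<eta> (n - 1) z) / of_real (g n)) / (1 + D n z) =
              K_A (\<theta> n) \<alpha> \<beta> n z / (K_G \<alpha> \<beta> n z * (of_real (g n) / (1 - (rho z)\<^sup>2)))"
            unfolding K(2) eq[OF K(1)] D using elim(2) by (simp add: diff_divide_distrib)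
        qed
      qed
      ultimately show ?thesis by (subst (asm) uniform_limit_cong) auto
    qed
  qed
  show ?thesis
  proof (intro conjI impI)
    show "asymp_off_interval (\<lambda>n z. K_H (\<theta> n) \<alpha> \<beta> n z)
        (\<lambda>n z. - K_G \<alpha> \<beta> n z * (1 - of_real (g n) * ((1 + (rho z)\<^sup>2) / (1 - (rho z)\<^sup>2))))"
      unfolding asymp_off_interval_def using main(1) by blast
    show "asymp_off_interval (\<lambda>n z. K_A (\<theta> n) \<alpha> \<beta> n z)
        (\<lambda>n z. K_G \<alpha> \<beta> n z * (of_real (g n) / (1 - (rho z)\<^sup>2)))" if "min \<alpha> \<beta> \<noteq> -1/2"
    proof -
      have "\<gamma> \<noteq> 0" using that by (simp add: \<gamma>_def)
      thus ?thesis unfolding asymp_off_interval_def using main(2) by blast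
    qed
    show "g \<sim>[sequentially] (\<lambda>n. (2 * \<alpha> + 1) / real n)" if "min \<alpha> \<beta> \<noteq> -1/2" "\<alpha> \<le> \<beta>"
      using that by (intro asymp) (auto simp: \<gamma>_def min_absorb1)
    show "g \<sim>[sequentially] (\<lambda>n. (2 * \<beta> + 1) / real n)" if "min \<alpha> \<beta> \<noteq> -1/2" "\<alpha> \<ge> \<beta>"
      using that by (intro asymp) (auto simp: \<gamma>_def min_absorb2)
  qed
qed

end
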